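(* Let $\pi\in S_k$ be a layered permutation, and let $\ell$ be the number of non-final layers of $\pi$ of size at least $2$. Then (1) $g(\pi,n)=\Theta\left((\log n)^{k-\ell-1}\right)$ as $n\to\infty$; (2) $P(\pi,r)=\Theta\left(r(\log r)^{k-\ell-1}\right)$ as $r\to\infty$.
   Context: A layered permutation $\pi\in S_k$ is one obtained from the descending permutation $k,k-1,\dots,1$ by reversing some of its contiguous blocks (descending runs), so that $\pi$ is a concatenation of increasing runs of consecutive values, each run consisting of values larger than all values in later runs. A layer is a maximal contiguous ascending run of $\pi$; its size is its number of entries; a non-final layer is a layer that is not at the end of $\pi$. (E.g. $789623451$ has layers $789,6,2345,1$.) A $\pi$-wave is an increasing sequence of integers $x_1<\cdots<x_{k+1}$ such that for all $1\le i,j\le k$, $x_{i+1}-x_i > x_{j+1}-x_j$ if and only if $\pi(i)>\pi(j)$. $g(\pi,n)$ is the largest cardinality of a subset of $[n]=\{1,\dots,n\}$ containing no $\pi$-wave. $P(\pi,r)$ is the least positive integer $M$ such that every $r$-coloring of $[M]$ contains a monochromatic $\pi$-wave. Implied constants may depend on $\pi$. *)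

theory Defs
  imports
    Complex_Main
    "HOL-Combinatorics.Permutations"
    "HOL-Library.Landau_Symbols"
    "HOL-Library.FuncSet"
begin

text \<open>
  A permutation in \<open>S\<^sub>k\<close> is a function \<open>\<pi> :: nat \<Rightarrow> nat\<close> with \<open>\<pi> permutes {1..k}\<close>;
  its one-line notation is the list \<open>map \<pi> [1..<k+1]\<close>.
\<close>

text \<open>
  The descending word is cut into contiguous blocks \<open>bs\<close> and every block is reversed. Blocks that
  are left alone correspond to cutting them into blocks of size 1.
\<close>
definition layered :: "nat \<Rightarrow> (nat \<Rightarrow> nat) \<Rightarrow> bool" where
  "layered k \<pi> \<longleftrightarrow>
     (\<exists>bs. concat bs = rev [1..<k+1] \<and> map \<pi> [1..<k+1] = concat (map rev bs))"

text \<open>Runs and layers are represented by the sets of positions that they occupy.\<close>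
definition ascending_runs :: "nat \<Rightarrow> (nat \<Rightarrow> nat) \<Rightarrow> nat set set" where
  "ascending_runs k \<pi> =
     {{a..b} | a b. 1 \<le> a \<and> a \<le> b \<and> b \<le> k \<and> strict_mono_on {a..b} \<pi>}"

definition layers :: "nat \<Rightarrow> (nat \<Rightarrow> nat) \<Rightarrow> nat set set" where
  "layers k \<pi> = {L \<in> ascending_runs k \<pi>. \<forall>R \<in> ascending_runs k \<pi>. L \<subseteq> R \<longrightarrow> R = L}"

text \<open>A layer is final iff it occupies the last position \<open>k\<close>.\<close>
definition num_big_nonfinal_layers :: "nat \<Rightarrow> (nat \<Rightarrow> nat) \<Rightarrow> nat" where
  "num_big_nonfinal_layers k \<pi> = card {L \<in> layers k \<pi>. k \<notin> L \<and> card L \<ge> 2}"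

text \<open>Only the values \<open>x 1, \<dots>, x (k + 1)\<close> are relevant.\<close>
definition wave :: "nat \<Rightarrow> (nat \<Rightarrow> nat) \<Rightarrow> (nat \<Rightarrow> int) \<Rightarrow> bool" where
  "wave k \<pi> x \<longleftrightarrow>
     strict_mono_on {1..k+1} x \<and>
     (\<forall>i\<in>{1..k}. \<forall>j\<in>{1..k}. x (i+1) - x i > x (j+1) - x j \<longleftrightarrow> \<pi> i > \<pi> j)"

definition contains_wave :: "nat \<Rightarrow> (nat \<Rightarrow> nat) \<Rightarrow> int set \<Rightarrow> bool" where
  "contains_wave k \<pi> A \<longleftrightarrow> (\<exists>x. wave k \<pi> x \<and> x ` {1..k+1} \<subseteq> A)"

definition g :: "nat \<Rightarrow> (nat \<Rightarrow> nat) \<Rightarrow> nat \<Rightarrow> nat" where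
  "g k \<pi> n = Max (card ` {A. A \<subseteq> {1..int n} \<and> \<not> contains_wave k \<pi> A})"

definition P :: "nat \<Rightarrow> (nat \<Rightarrow> nat) \<Rightarrow> nat \<Rightarrow> nat" where
  "P k \<pi> r = (LEAST M. M > 0 \<and>
     (\<forall>c \<in> {1..int M} \<rightarrow> {1..r}. \<exists>q. contains_wave k \<pi> {y \<in> {1..int M}. c y = q}))"

end

theory Submission
  imports Defs "HOL-Real_Asymp.Real_Asymp"
begin

text \<open>
  Peel off the layers from the front. Say the first layer has size \<open>s\<close> and the rest of the
  permutation is the tail.

  Lower bounds. If \<open>T\<close> lies in \<open>[0, M)\<close> and avoids the tail, consider the sums \<open>4 M y + t\<close> with
  \<open>y \<in> Y\<close> and \<open>t \<in> T\<close>. In a wave inside this set some gap after the first layer must leave a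
  block of size \<open>M\<close>, so all gaps of the first layer do as well, and the wave projects to \<open>Y\<close>.
  There it is ruled out by taking powers of two (\<open>s = 1\<close>) or a set without \<open>s\<close> increasing
  gaps (\<open>s \<ge> 2\<close>).

  Upper bounds. For \<open>s = 1\<close> split a set dyadically by the distance to its minimum. For \<open>s \<ge> 2\<close>
  cut the set into consecutive chunks, each containing a sub-block that is large enough for a tail
  and shorter than half of the chunk. If many chunks have length about \<open>U\<close>, then a sparse
  selection of their left ends contains \<open>s - 1\<close> increasing gaps. Both ends of the first selected
  chunk can be used, which gives one further gap of length about \<open>U\<close> for free, and the tail is
  found in the sub-block of the last one. So a layer of size \<open>s\<close> costs only \<open>s - 1\<close> logarithms.

  For the coloring, a wave-free set \<open>A\<close> is perturbed to a complete system of residues modulo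
  \<open>card A\<close>, whose translates by the multiples of \<open>card A\<close> tile the integers.
\<close>

section \<open>Waves and weak waves\<close>

definition gap :: "(nat \<Rightarrow> int) \<Rightarrow> nat \<Rightarrow> int" where
  "gap x i = x (Suc i) - x i"

lemma strict_mono_on_gap_iff:
  "strict_mono_on {1..Suc k} x \<longleftrightarrow> (\<forall>i\<in>{1..k}. 0 < gap x i)"
proof
  assume "strict_mono_on {1..Suc k} x"
  then show "\<forall>i\<in>{1..k}. 0 < gap x i"
    by (auto simp: strict_mono_on_def gap_def)
next
  assume pos: "\<forall>i\<in>{1..k}. 0 < gap x i"
  have "x i < x j" if "i < j" "1 \<le> i" "j \<le> Suc k" for i j
    using that
  proof (induction j)
    case (Suc j)
    have "x j < x (Suc j)"
      using pos Suc.prems by (auto simp: gap_def)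
    then show ?case
      using Suc by (cases "i = j") auto
  qed simp
  then show "strict_mono_on {1..Suc k} x"
    by (auto simp: strict_mono_on_def)
qed

lemma wave_gap_iff:
  "wave k f x \<longleftrightarrow> (\<forall>i\<in>{1..k}. 0 < gap x i) \<and>
     (\<forall>i\<in>{1..k}. \<forall>j\<in>{1..k}. gap x j < gap x i \<longleftrightarrow> f j < f i)"
  unfolding wave_def strict_mono_on_gap_iff [symmetric] by (simp add: gap_def)

lemma wave_increasing:
  assumes "strict_mono_on {1..s} f"
  shows "wave s f x \<longleftrightarrow> wave s id x"
proof -
  have "f j < f i \<longleftrightarrow> j < i" if "i \<in> {1..s}" "j \<in> {1..s}" for i j
    using assms that by (metis strict_mono_on_less)
  then show ?thesis
    by (simp add: wave_gap_iff)
qed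

lemma wave_idI:
  assumes "\<And>i. i \<in> {1..s} \<Longrightarrow> 0 < gap x i"
    and "\<And>i. 1 \<le> i \<Longrightarrow> i < s \<Longrightarrow> gap x i < gap x (Suc i)"
  shows "wave s id x"
proof -
  have less: "gap x i < gap x j" if "i < j" "1 \<le> i" "j \<le> s" for i j
    using that
  proof (induction j)
    case (Suc j)
    have "gap x j < gap x (Suc j)"
      using assms(2) Suc.prems by auto
    then show ?case
      using Suc by (cases "i = j") auto
  qed simp
  then have "gap x j < gap x i \<longleftrightarrow> j < i" if "i \<in> {1..s}" "j \<in> {1..s}" for i j
    using that less[of j i] less[of i j] by (cases i j rule: linorder_cases) (auto dest: order.strict_trans)
  then show ?thesis
    using assms(1) by (simp add: wave_gap_iff)
qed

lemma wave_gap_le_diam: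
  assumes "wave k f x" "i \<in> {1..k}"
  shows "gap x i \<le> x (Suc k) - x 1"
proof -
  have "strict_mono_on {1..Suc k} x"
    using assms(1) by (simp add: wave_def)
  then have "x (Suc i) \<le> x (Suc k)" "x 1 \<le> x i"
    using strict_mono_on_leD[of "{1..Suc k}" x] assms(2) by simp_all
  then show ?thesis
    by (simp add: gap_def)
qed

lemma gap_shift: "gap (\<lambda>j. x (s + j)) j = gap x (s + j)"
  by (simp add: gap_def)

lemma contains_wave_mono:
  "contains_wave k f A \<Longrightarrow> A \<subseteq> B \<Longrightarrow> contains_wave k f B"
  by (auto simp: contains_wave_def)

text \<open>The head gaps increase, so the first of them is the smallest; comparing the tail gaps
  with it alone settles every comparison between head and tail.\<close>

lemma wave_joinI:
  assumes head: "wave s id x"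
    and f: "strict_mono_on {1..s} f" "\<forall>i\<in>{1..s}. \<forall>j\<in>{1..k}. f (s + j) < f i"
    and tail: "wave k (\<lambda>j. f (s + j)) (\<lambda>j. x (s + j))"
    and small: "\<And>j. j \<in> {1..k} \<Longrightarrow> gap x (s + j) < gap x 1"
  shows "wave (s + k) f x"
proof -
  have H: "wave s f x"
    using wave_increasing head f(1) by blast
  have big: "gap x (s + j) < gap x i" if "i \<in> {1..s}" "j \<in> {1..k}" for i j
  proof -
    have "gap x 1 \<le> gap x i"
      using head that(1) by (cases "i = 1") (force simp: wave_gap_iff intro: less_imp_le)+
    then show ?thesis
      using small[OF that(2)] by simp
  qed
  have split: "i \<in> {1..s} \<or> (\<exists>j\<in>{1..k}. i = s + j)" if "i \<in> {1..s + k}" for i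
    using that by (cases "i \<le> s") (auto intro!: bexI[of _ "i - s"])
  show ?thesis
    unfolding wave_gap_iff
  proof (intro conjI ballI)
    fix i assume "i \<in> {1..s + k}"
    from split[OF this] show "0 < gap x i"
      using H tail by (auto simp: wave_gap_iff gap_shift)
  next
    fix i j assume "i \<in> {1..s + k}" "j \<in> {1..s + k}"
    from split[OF this(1)] split[OF this(2)]
    show "gap x j < gap x i \<longleftrightarrow> f j < f i"
    proof (elim disjE bexE)
      assume "i \<in> {1..s}" "j \<in> {1..s}"
      then show ?thesis using H unfolding wave_gap_iff by blast
    next
      fix j' assume "i \<in> {1..s}" "j' \<in> {1..k}" "j = s + j'"
      then show ?thesis using big f(2) by blast
    next
      fix i' assume *: "j \<in> {1..s}" "i' \<in> {1..k}" "i = s + i'"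
      then have "gap x i < gap x j" "f i < f j" using big f(2) by blast+
      then show ?thesis by simp
    next
      fix i' j' assume "i' \<in> {1..k}" "i = s + i'" "j' \<in> {1..k}" "j = s + j'"
      then show ?thesis using tail unfolding wave_gap_iff gap_shift by blast
    qed
  qed
qed

text \<open>The pattern is described by order conditions only, so that the tail after a layer, a
  shift of \<open>f\<close>, is of the same kind. The index \<open>e\<close> adds up the cost of the
  layers: \<open>s - 1\<close> each, except that a non-final layer of size 1 costs 1.\<close>

inductive layer_exponent :: "nat \<Rightarrow> (nat \<Rightarrow> nat) \<Rightarrow> nat \<Rightarrow> bool" where
  single: "1 \<le> s \<Longrightarrow> strict_mono_on {1..s} f \<Longrightarrow> layer_exponent s f (s - 1)"
| layer: "1 \<le> s \<Longrightarrow> strict_mono_on {1..s} f \<Longrightarrow>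
    \<forall>i\<in>{1..s}. \<forall>j\<in>{1..k}. f (s + j) < f i \<Longrightarrow>
    layer_exponent k (\<lambda>j. f (s + j)) e \<Longrightarrow>
    layer_exponent (s + k) f ((if s = 1 then 1 else s - 1) + e)"

lemma layer_exponent_pos: "layer_exponent k f e \<Longrightarrow> 1 \<le> k"
  by (induction rule: layer_exponent.induct) auto

text \<open>Avoiding these weak patterns is stable under rescaling by a large factor and perturbing, which
  is what turns a wave-free set into a complete system of residues for the coloring bound.\<close>

definition weak_wave :: "nat \<Rightarrow> (nat \<Rightarrow> nat) \<Rightarrow> (nat \<Rightarrow> int) \<Rightarrow> bool" where
  "weak_wave k f x \<longleftrightarrow> (\<forall>i\<in>{1..k}. 0 < gap x i) \<and>
     (\<forall>i\<in>{1..k}. \<forall>j\<in>{1..k}. f j < f i \<longrightarrow> gap x j \<le> gap x i)"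

definition weak_free :: "nat \<Rightarrow> (nat \<Rightarrow> nat) \<Rightarrow> int set \<Rightarrow> bool" where
  "weak_free k f A \<longleftrightarrow> (\<forall>x. weak_wave k f x \<longrightarrow> \<not> x ` {1..k+1} \<subseteq> A)"

lemma weak_wave_restrict:
  "weak_wave (s + k) f x \<Longrightarrow> weak_wave s f x"
  by (auto simp: weak_wave_def)

lemma weak_wave_tail:
  "weak_wave (s + k) f x \<Longrightarrow> weak_wave k (\<lambda>j. f (s + j)) (\<lambda>j. x (s + j))"
  by (auto simp: weak_wave_def gap_shift)

lemma weak_wave_increasing:
  assumes "strict_mono_on {1..s} f"
  shows "weak_wave s f x \<longleftrightarrow> weak_wave s id x"
proof -
  have "f j < f i \<longleftrightarrow> j < i" if "i \<in> {1..s}" "j \<in> {1..s}" for i j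
    using assms that by (metis strict_mono_on_less)
  then show ?thesis
    by (simp add: weak_wave_def)
qed

lemma weak_free_increasing:
  "strict_mono_on {1..s} f \<Longrightarrow> weak_free s f A \<longleftrightarrow> weak_free s id A"
  by (simp add: weak_free_def weak_wave_increasing)

lemma weak_wave_translate:
  "weak_wave k f (\<lambda>i. x i - c) \<longleftrightarrow> weak_wave k f x"
  by (simp add: weak_wave_def gap_def)

section \<open>Counting layers\<close>

lemma layers_single:
  assumes "1 \<le> s" "strict_mono_on {1..s} f"
  shows "layers s f = {{1..s}}"
proof -
  have "{1..s} \<in> ascending_runs s f"
    using assms by (auto simp: ascending_runs_def)
  moreover have "R \<subseteq> {1..s}" if "R \<in> ascending_runs s f" for R
    using that by (auto simp: ascending_runs_def)
  ultimately show ?thesis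
    unfolding layers_def by blast
qed

lemma strict_mono_on_shift:
  fixes f :: "nat \<Rightarrow> nat"
  shows "strict_mono_on ((+) s ` S) f \<longleftrightarrow> strict_mono_on S (\<lambda>j. f (s + j))"
  by (auto simp: strict_mono_on_def)

text \<open>A run across the boundary would contain \<open>s\<close> and a later position
  \<open>b\<close>, forcing \<open>f s < f b\<close> against the descent from the layer to the tail.
  Inside the layer every interval is a run.\<close>

lemma ascending_runs_layer:
  assumes s: "1 \<le> s" "strict_mono_on {1..s} f"
    and desc: "\<forall>i\<in>{1..s}. \<forall>j\<in>{1..k}. f (s + j) < f i"
  shows "ascending_runs (s + k) f =
    {R. \<exists>a b. R = {a..b} \<and> 1 \<le> a \<and> a \<le> b \<and> b \<le> s} \<union>
    (`) ((+) s) ` ascending_runs k (\<lambda>j. f (s + j))"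
    (is "?L = ?R1 \<union> ?R2")
proof (intro equalityI subsetI)
  fix R assume "R \<in> ?L"
  then obtain a b where R: "R = {a..b}" "1 \<le> a" "a \<le> b" "b \<le> s + k" "strict_mono_on {a..b} f"
    by (auto simp: ascending_runs_def)
  consider "b \<le> s" | "s < a" | "a \<le> s" "s < b" by linarith
  then show "R \<in> ?R1 \<union> ?R2"
  proof cases
    case 1
    then show ?thesis using R by blast
  next
    case 2
    then have "R = (+) s ` {a - s..b - s}"
      using R by auto
    moreover from this have "strict_mono_on {a - s..b - s} (\<lambda>j. f (s + j))"
      unfolding strict_mono_on_shift [symmetric] using R(1,5) by argo
    then have "{a - s..b - s} \<in> ascending_runs k (\<lambda>j. f (s + j))"
      unfolding ascending_runs_def using R 2
      by (intro CollectI exI[of _ "a - s"] exI[of _ "b - s"] conjI refl) auto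
    ultimately show ?thesis by blast
  next
    case 3
    then have "f s < f b"
      using R(5) by (auto simp: strict_mono_on_def)
    moreover have "b - s \<in> {1..k}" "s \<in> {1..s}"
      using s(1) 3 R(4) by auto
    then have "f (s + (b - s)) < f s"
      using desc by blast
    ultimately show ?thesis using 3 by simp
  qed
next
  fix R assume "R \<in> ?R1 \<union> ?R2"
  then show "R \<in> ?L"
  proof
    assume "R \<in> ?R1"
    then obtain a b where R: "R = {a..b}" "1 \<le> a" "a \<le> b" "b \<le> s" by blast
    then have "strict_mono_on {a..b} f"
      using s(2) by (auto simp: strict_mono_on_def)
    then show ?thesis
      using R by (auto simp: ascending_runs_def intro!: exI[of _ a] exI[of _ b])
  next
    assume "R \<in> ?R2"
    then obtain a b where R: "R = (+) s ` {a..b}" "1 \<le> a" "a \<le> b" "b \<le> k"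
        "strict_mono_on {a..b} (\<lambda>j. f (s + j))"
      by (auto simp: ascending_runs_def)
    then have "strict_mono_on ((+) s ` {a..b}) f"
      unfolding strict_mono_on_shift by blast
    then have "strict_mono_on {s + a..s + b} f"
      by (simp add: add.commute)
    then show ?thesis
      using R by (auto simp: ascending_runs_def add.commute intro!: exI[of _ "s + a"] exI[of _ "s + b"])
  qed
qed

text \<open>Runs inside the layer and runs of the tail occupy disjoint positions, so maximality can
  be checked within each family; in the first family only the whole layer is maximal.\<close>

lemma layers_layer:
  assumes s: "1 \<le> s" "strict_mono_on {1..s} f"
    and desc: "\<forall>i\<in>{1..s}. \<forall>j\<in>{1..k}. f (s + j) < f i"
  shows "layers (s + k) f = insert {1..s} ((`) ((+) s) ` layers k (\<lambda>j. f (s + j)))"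
proof -
  let ?R1 = "{R. \<exists>a b. R = {a..b} \<and> 1 \<le> a \<and> a \<le> b \<and> b \<le> s}"
  let ?X = "ascending_runs k (\<lambda>j. f (s + j))"
  have runs: "ascending_runs (s + k) f = ?R1 \<union> (`) ((+) s) ` ?X"
    using ascending_runs_layer[OF assms] .
  have R1: "R \<noteq> {} \<and> R \<subseteq> {1..s}" if "R \<in> ?R1" for R
    using that by auto
  have R2: "R \<noteq> {} \<and> R \<inter> {1..s} = {}" if "R \<in> (`) ((+) s) ` ?X" for R
    using that by (auto simp: ascending_runs_def)
  have sub: "(+) s ` L \<subseteq> (+) s ` R \<longleftrightarrow> L \<subseteq> R" "(+) s ` L = (+) s ` R \<longleftrightarrow> L = R" for L R
    by (auto simp: inj_image_subset_iff inj_image_eq_iff)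
  show ?thesis
  proof (intro equalityI subsetI)
    fix L assume "L \<in> layers (s + k) f"
    then have L: "L \<in> ?R1 \<union> (`) ((+) s) ` ?X" "\<And>R. R \<in> ?R1 \<union> (`) ((+) s) ` ?X \<Longrightarrow> L \<subseteq> R \<Longrightarrow> R = L"
      unfolding layers_def runs by blast+
    from L(1) show "L \<in> insert {1..s} ((`) ((+) s) ` layers k (\<lambda>j. f (s + j)))"
    proof
      assume "L \<in> ?R1"
      moreover have "{1..s} \<in> ?R1" using s(1) by blast
      ultimately have "L = {1..s}" using L(2)[of "{1..s}"] R1 by blast
      then show ?thesis by blast
    next
      assume "L \<in> (`) ((+) s) ` ?X"
      then obtain L' where L': "L' \<in> ?X" "L = (+) s ` L'" by blast
      have "R = L'" if "R \<in> ?X" "L' \<subseteq> R" for R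
        using L(2)[of "(+) s ` R"] that unfolding L'(2) sub by blast
      with L'(1) have "L' \<in> layers k (\<lambda>j. f (s + j))"
        unfolding layers_def by blast
      then show ?thesis using L'(2) by blast
    qed
  next
    fix L assume "L \<in> insert {1..s} ((`) ((+) s) ` layers k (\<lambda>j. f (s + j)))"
    then show "L \<in> layers (s + k) f"
    proof
      assume L: "L = {1..s}"
      have "{1..s} \<in> ?R1" using s(1) by blast
      then have "L \<in> ?R1 \<union> (`) ((+) s) ` ?X" using L by blast
      moreover have "R = L" if "R \<in> ?R1 \<union> (`) ((+) s) ` ?X" "L \<subseteq> R" for R
        using that(1)
      proof
        assume "R \<in> ?R1" then show ?thesis using R1[of R] that(2) L by blast
      next
        assume "R \<in> (`) ((+) s) ` ?X"
        then show ?thesis using R2[of R] that(2) L s(1) by auto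
      qed
      ultimately show ?thesis
        unfolding layers_def runs by (intro CollectI conjI ballI impI)
    next
      assume "L \<in> (`) ((+) s) ` layers k (\<lambda>j. f (s + j))"
      then obtain L' where L': "L' \<in> ?X" "\<And>R. R \<in> ?X \<Longrightarrow> L' \<subseteq> R \<Longrightarrow> R = L'" "L = (+) s ` L'"
        unfolding layers_def by blast
      have "R = L" if "R \<in> ?R1 \<union> (`) ((+) s) ` ?X" "L \<subseteq> R" for R
        using that(1)
      proof
        assume "R \<in> ?R1"
        then show ?thesis using R1[of R] R2[of L] that(2) L' by blast
      next
        assume "R \<in> (`) ((+) s) ` ?X"
        then obtain R' where R': "R' \<in> ?X" "R = (+) s ` R'" by blast
        then show ?thesis using L'(2)[of R'] that(2) unfolding L'(3) R'(2) sub by blast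
      qed
      moreover have "L \<in> ?R1 \<union> (`) ((+) s) ` ?X" using L'(1,3) by blast
      ultimately show ?thesis
        unfolding layers_def runs by (intro CollectI conjI ballI impI)
    qed
  qed
qed

lemma finite_layers: "finite (layers k f)"
  by (rule finite_subset[of _ "Pow {1..k}"]) (auto simp: layers_def ascending_runs_def)

lemma num_big_nonfinal_layers_layer:
  assumes s: "1 \<le> s" "strict_mono_on {1..s} f"
    and desc: "\<forall>i\<in>{1..s}. \<forall>j\<in>{1..k}. f (s + j) < f i" and k: "1 \<le> k"
  shows "num_big_nonfinal_layers (s + k) f =
    (if s = 1 then 0 else 1) + num_big_nonfinal_layers k (\<lambda>j. f (s + j))"
proof -
  let ?B = "{L \<in> layers k (\<lambda>j. f (s + j)). k \<notin> L \<and> card L \<ge> 2}"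
  have card_shift: "card ((+) s ` L) = card L" for L
    by (intro card_image) simp
  have "{L \<in> layers (s + k) f. s + k \<notin> L \<and> card L \<ge> 2} =
      (if s = 1 then {} else {{1..s}}) \<union> (`) ((+) s) ` ?B"
  proof -
    have filter_insert: "{L \<in> insert X (F ` Z). Q L} =
        (if Q X then {X} else {}) \<union> F ` {L \<in> Z. Q (F L)}" for X and F :: "nat set \<Rightarrow> nat set" and Z Q
      by auto
    have "s + k \<in> (+) s ` L \<longleftrightarrow> k \<in> L" for L by auto
    then have "{L \<in> insert X ((`) ((+) s) ` Z). s + k \<notin> L \<and> card L \<ge> 2} =
        (if s + k \<notin> X \<and> card X \<ge> 2 then {X} else {}) \<union>
        (`) ((+) s) ` {L \<in> Z. k \<notin> L \<and> card L \<ge> 2}" for X Z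
      unfolding filter_insert card_shift by simp
    moreover have "s + k \<notin> {1..s} \<and> card {1..s} \<ge> 2 \<longleftrightarrow> s \<noteq> 1"
      using s(1) k by auto
    ultimately show ?thesis
      unfolding layers_layer[OF assms(1-3)] by simp
  qed
  moreover have "{1..s} \<notin> (`) ((+) s) ` ?B"
  proof
    assume "{1..s} \<in> (`) ((+) s) ` ?B"
    then obtain L where L: "L \<in> layers k (\<lambda>j. f (s + j))" "{1..s} = (+) s ` L" by blast
    then have "L \<subseteq> {1..k}" by (auto simp: layers_def ascending_runs_def)
    moreover have "1 \<in> (+) s ` L" using L(2) s(1) by auto
    ultimately show False using s(1) by force
  qed
  moreover have "card ((`) ((+) s) ` ?B) = card ?B"
    by (intro card_image inj_onI) (simp add: inj_image_eq_iff)
  moreover have "finite ?B" using finite_layers by auto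
  moreover have "card ((if s = 1 then {} else {X}) \<union> Z) = (if s = 1 then 0 else 1) + card Z"
    if "X \<notin> Z" "finite Z" for X :: "nat set" and Z
    using that by simp
  ultimately show ?thesis
    unfolding num_big_nonfinal_layers_def by (metis (no_types, lifting) finite_imageI)
qed

text \<open>A layer of size \<open>s\<close> contributes \<open>s\<close> to \<open>k\<close>. The
  final layer loses 1 from this in \<open>e\<close>, and a non-final layer loses 1 exactly when it
  is counted as big.\<close>

lemma layer_exponent_num_big:
  "layer_exponent k f e \<Longrightarrow> e + num_big_nonfinal_layers k f + 1 = k"
proof (induction rule: layer_exponent.induct)
  case (single s f)
  have "{L \<in> layers s f. s \<notin> L \<and> card L \<ge> 2} = {}"
    using layers_single[OF single] single by auto
  then have "num_big_nonfinal_layers s f = 0"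
    unfolding num_big_nonfinal_layers_def by (simp only: card.empty)
  then show ?case
    using single(1) by simp
next
  case (layer s f k e)
  then show ?case
    using num_big_nonfinal_layers_layer[OF layer(1-3) layer_exponent_pos[OF layer(4)]] by auto
qed

section \<open>From blocks of the descending word to the recursion on layers\<close>

lemma upt_split_shift: "[1..<s + k + 1] = [1..<s + 1] @ map ((+) s) [1..<k + 1]"
proof -
  have "[1..<s + k + 1] = [1..<s + 1] @ [s + 1..<s + 1 + k]"
    using upt_add_eq_append[of 1 "s + 1" k] by simp
  moreover have "[s + 1..<s + 1 + k] = map ((+) s) [1..<k + 1]"
    by (rule nth_equalityI) (simp_all del: upt_Suc)
  ultimately show ?thesis by simp
qed

text \<open>The first block of the descending word holds the \<open>s\<close> largest values, so
  reversing it gives an increasing layer above everything that follows. The remaining blocks cut the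
  descending word of length \<open>k'\<close>, to which the induction applies.\<close>

lemma layered_blocks_exponent:
  assumes "concat bs = rev [1..<k + 1]" "map f [1..<k + 1] = concat (map rev bs)"
    and "[] \<notin> set bs" "1 \<le> k"
  shows "\<exists>e. layer_exponent k f e"
  using assms
proof (induction bs arbitrary: k f)
  case Nil
  then show ?case by simp
next
  case (Cons b bs)
  define s where "s = length b"
  define k' where "k' = length (concat bs)"
  have "length (concat (b # bs)) = k"
    unfolding Cons.prems(1) by simp
  then have k: "k = s + k'"
    by (simp add: s_def k'_def)
  have s: "1 \<le> s"
    using Cons.prems(3) by (cases b) (auto simp: s_def)
  have "[1..<k + 1] = [1..<k' + 1] @ map ((+) k') [1..<s + 1]"
    using upt_split_shift[of k' s] by (simp add: k add.commute)
  then have "b @ concat bs = rev (map ((+) k') [1..<s + 1]) @ rev [1..<k' + 1]"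
    using Cons.prems(1) by simp
  then have b: "b = rev (map ((+) k') [1..<s + 1])" and bs: "concat bs = rev [1..<k' + 1]"
    by (simp_all add: append_eq_append_conv s_def del: upt_Suc)
  have "map f [1..<k + 1] = map f [1..<s + 1] @ map (\<lambda>j. f (s + j)) [1..<k' + 1]"
    unfolding k upt_split_shift by (simp add: comp_def)
  then have "map f [1..<s + 1] @ map (\<lambda>j. f (s + j)) [1..<k' + 1] = rev b @ concat (map rev bs)"
    using Cons.prems(2) by simp
  then have head: "map f [1..<s + 1] = rev b"
    and tail: "map (\<lambda>j. f (s + j)) [1..<k' + 1] = concat (map rev bs)"
    by (simp_all add: append_eq_append_conv s_def del: upt_Suc)
  have f_head: "f i = k' + i" if "i \<in> {1..s}" for i
  proof -
    have "map f [1..<s + 1] = map ((+) k') [1..<s + 1]"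
      using head b by simp
    then show ?thesis
      using that unfolding map_eq_conv by (simp del: upt_Suc)
  qed
  have mono: "strict_mono_on {1..s} f"
    using f_head by (simp add: strict_mono_on_def)
  show ?case
  proof (cases "k' = 0")
    case True
    then show ?thesis
      using layer_exponent.single[OF s mono] k by auto
  next
    case False
    then obtain e where e: "layer_exponent k' (\<lambda>j. f (s + j)) e"
      using Cons.IH[OF bs tail] Cons.prems(3) by auto
    have "f (s + j) \<le> k'" if "j \<in> {1..k'}" for j
    proof -
      have "f (s + j) \<in> set (concat (map rev bs))"
        using that by (subst tail[symmetric]) (auto simp del: upt_Suc)
      also have "\<dots> = set (concat bs)" by auto
      also have "\<dots> = {1..<k' + 1}" unfolding bs by (simp del: upt_Suc)
      finally show ?thesis by simp
    qed
    then have "\<forall>i\<in>{1..s}. \<forall>j\<in>{1..k'}. f (s + j) < f i"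
      using f_head by fastforce
    from layer_exponent.layer[OF s mono this e] show ?thesis
      unfolding k by blast
  qed
qed

lemma layered_imp_layer_exponent:
  assumes "layered k f" "1 \<le> k"
  shows "layer_exponent k f (k - num_big_nonfinal_layers k f - 1)"
proof -
  obtain bs where bs: "concat bs = rev [1..<k + 1]" "map f [1..<k + 1] = concat (map rev bs)"
    using assms(1) by (auto simp: layered_def)
  \<comment> \<open>The cutting may contain empty blocks; deleting them changes neither
    concatenation.\<close>
  define bs' where "bs' = filter (\<lambda>b. b \<noteq> []) bs"
  have "concat bs' = concat bs" "concat (map rev bs') = concat (map rev bs)"
    unfolding bs'_def by (induction bs) auto
  then obtain e where e: "layer_exponent k f e"
    using layered_blocks_exponent[of bs' k f] bs assms(2) by (auto simp: bs'_def)
  moreover have "e = k - num_big_nonfinal_layers k f - 1"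
    using layer_exponent_num_big[OF e] by simp
  ultimately show ?thesis by simp
qed

section \<open>Large wave-free sets\<close>

text \<open>Copies of \<open>T\<close> sit at the multiples of \<open>4 * M\<close> indexed by
  \<open>Y\<close>. When \<open>T\<close> lies in [0, M), division by \<open>4 * M\<close> recovers
  the block, and each gap is \<open>4 * M\<close> times the gap between blocks, up to an error below
  \<open>M\<close>.\<close>

definition two_scale :: "int \<Rightarrow> int set \<Rightarrow> int set \<Rightarrow> int set" where
  "two_scale M Y T = (\<lambda>(y, t). 4 * M * y + t) ` (Y \<times> T)"

lemma two_scale_div:
  assumes "T \<subseteq> {0..<M}" "z \<in> two_scale M Y T"
  shows "z div (4 * M) \<in> Y" "z - 4 * M * (z div (4 * M)) \<in> T"
proof -
  obtain y t where yt: "y \<in> Y" "t \<in> T" "z = 4 * M * y + t"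
    using assms(2) by (auto simp: two_scale_def)
  then have t: "0 \<le> t" "t < M"
    using assms(1) by auto
  then have "z div (4 * M) = y"
    using yt(3) by (simp add: div_pos_pos_trivial)
  then show "z div (4 * M) \<in> Y" "z - 4 * M * (z div (4 * M)) \<in> T"
    using yt by auto
qed

lemma card_two_scale:
  assumes "T \<subseteq> {0..<M}"
  shows "card (two_scale M Y T) = card Y * card T"
proof -
  have "inj_on (\<lambda>(y, t). 4 * M * y + t) (Y \<times> T)"
  proof (rule inj_onI, clarify)
    fix y t y' t' assume *: "t \<in> T" "t' \<in> T" "4 * M * y + t = 4 * M * y' + t'"
    then have t: "0 \<le> t" "t < M" "0 \<le> t'" "t' < M"
      using assms by auto
    then have "(4 * M * y + t) div (4 * M) = y" "(4 * M * y' + t') div (4 * M) = y'"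
      by (simp_all add: div_pos_pos_trivial)
    with * show "y = y' \<and> t = t'"
      by simp
  qed
  then show ?thesis
    by (simp add: two_scale_def card_image card_cartesian_product)
qed

lemma two_scale_bounds:
  assumes "T \<subseteq> {0..<M}" "Y \<subseteq> {0..<K}"
  shows "two_scale M Y T \<subseteq> {0..<4 * M * K}"
proof
  fix z assume "z \<in> two_scale M Y T"
  then obtain y t where yt: "y \<in> Y" "t \<in> T" "z = 4 * M * y + t"
    by (auto simp: two_scale_def)
  then have t: "0 \<le> t" "t < M" "0 \<le> y" "y \<le> K - 1"
    using assms by auto
  then have "4 * M * y \<le> 4 * M * (K - 1)" "0 \<le> 4 * M * y"
    by (auto intro!: mult_left_mono mult_nonneg_nonneg)
  then show "z \<in> {0..<4 * M * K}"
    using t yt(3) by (simp add: algebra_simps)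
qed

lemma two_scale_gap:
  assumes T: "T \<subseteq> {0..<M}" and x: "x i \<in> two_scale M Y T" "x (Suc i) \<in> two_scale M Y T"
  shows "4 * M * gap (\<lambda>i. x i div (4 * M)) i - M < gap x i"
    "gap x i < 4 * M * gap (\<lambda>i. x i div (4 * M)) i + M"
proof -
  have "x i - 4 * M * (x i div (4 * M)) \<in> T" "x (Suc i) - 4 * M * (x (Suc i) div (4 * M)) \<in> T"
    using two_scale_div(2) T x by blast+
  then have "x i - 4 * M * (x i div (4 * M)) \<in> {0..<M}" "x (Suc i) - 4 * M * (x (Suc i) div (4 * M)) \<in> {0..<M}"
    using T by blast+
  then show "4 * M * gap (\<lambda>i. x i div (4 * M)) i - M < gap x i"
    "gap x i < 4 * M * gap (\<lambda>i. x i div (4 * M)) i + M"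
    unfolding gap_def by (auto simp: right_diff_distrib)
qed

lemma two_scale_gap_mono:
  assumes T: "T \<subseteq> {0..<M}"
    and xi: "x i \<in> two_scale M Y T" "x (Suc i) \<in> two_scale M Y T"
    and xj: "x j \<in> two_scale M Y T" "x (Suc j) \<in> two_scale M Y T"
    and le: "gap x i \<le> gap x j"
  shows "gap (\<lambda>i. x i div (4 * M)) i \<le> gap (\<lambda>i. x i div (4 * M)) j"
proof (rule ccontr)
  let ?y = "\<lambda>i. x i div (4 * M)"
  assume "\<not> ?thesis"
  then have "gap ?y j + 1 \<le> gap ?y i" by simp
  moreover have "0 < M"
    using T two_scale_div(2)[OF T xi(1)] by fastforce
  \<comment> \<open>Two errors below \<open>M\<close> cannot make up for the \<open>4 * M\<close> by
    which the block gaps would be in the wrong order.\<close>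
  ultimately have "4 * M * (gap ?y j + 1) \<le> 4 * M * gap ?y i"
    by (intro mult_left_mono) auto
  with two_scale_gap(1)[OF T xi] two_scale_gap(2)[OF T xj] le \<open>0 < M\<close>
  show False
    by (simp add: algebra_simps)
qed

lemma mono_chain:
  fixes y :: "nat \<Rightarrow> int"
  assumes "\<And>i. a \<le> i \<Longrightarrow> i < b \<Longrightarrow> y i \<le> y (Suc i)" "a \<le> b"
  shows "y a \<le> y b"
  using assms(2,1) by (induction b rule: dec_induct) force+

text \<open>Applied to block indices: either a stretch of points stays in one block and gives a
  forbidden pattern in \<open>T\<close>, or one of its gaps jumps to a later block.\<close>

lemma jump_or_constant:
  fixes y :: "nat \<Rightarrow> int"
  assumes "\<And>i. a \<le> i \<Longrightarrow> i < b \<Longrightarrow> y i \<le> y (Suc i)"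
  shows "(\<forall>i\<in>{a..b}. y i = y a) \<or> (\<exists>j. a \<le> j \<and> j < b \<and> 0 < gap y j)"
proof (rule disjCI)
  assume no: "\<not> (\<exists>j. a \<le> j \<and> j < b \<and> 0 < gap y j)"
  have "i \<le> b \<longrightarrow> y i = y a" if "a \<le> i" for i
    using that
  proof (induction i rule: nat_induct_at_least)
    case (Suc i)
    have "y i \<le> y (Suc i)" "\<not> 0 < gap y i" if "i < b"
      using no assms[of i] Suc.hyps that by blast+
    then have "y (Suc i) = y i" if "i < b"
      using that by (simp add: gap_def)
    then show ?case
      using Suc.IH by (metis Suc_leD Suc_le_eq)
  qed simp
  then show "\<forall>i\<in>{a..b}. y i = y a"
    unfolding Ball_def atLeastAtMost_iff by blast
qed

section \<open>Large sets without weakly increasing gap sequences\<close>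

lemma powers_of_two_gap:
  fixes p q :: int
  assumes "p \<in> range (\<lambda>a. 2 ^ a)" "q \<in> range (\<lambda>a. 2 ^ a)" "p < q"
  shows "p \<le> q - p"
proof -
  obtain a b where ab: "p = 2 ^ a" "q = 2 ^ b" using assms by blast
  with assms(3) have "a < b" by simp
  then have "(2::int) ^ Suc a \<le> 2 ^ b"
    by (intro power_increasing) auto
  then show ?thesis using ab by simp
qed

text \<open>Induction on \<open>s\<close>, each step multiplying the size by \<open>m\<close>. The
  block indices approach \<open>2 ^ m\<close> along powers of two, so the gap after a jump is always
  smaller than the jump. Hence the first \<open>s + 1\<close> points would stay in one block, which
  \<open>T\<close> excludes.\<close>

lemma weak_free_increasing_sets:
  assumes "1 \<le> s"
  shows "\<exists>c. \<forall>m\<ge>1. \<exists>A. A \<subseteq> {0..<2 ^ (c * m)} \<and> card A = m ^ (s - 1) \<and> weak_free s id A"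
  using assms
proof (induction s rule: dec_induct)
  case base
  have "weak_free 1 id {0}"
    by (simp add: weak_free_def weak_wave_def gap_def image_subset_iff) (metis atLeastAtMost_iff le_refl less_irrefl One_nat_def le_SucI)
  then show ?case
    by (intro exI[of _ 0] allI impI exI[of _ "{0}"]) (auto simp: id_def)
next
  case (step s)
  from step.IH obtain c where c: "\<And>m. m \<ge> 1 \<Longrightarrow>
      \<exists>A. A \<subseteq> {0..<2 ^ (c * m)} \<and> card A = m ^ (s - 1) \<and> weak_free s id A"
    by blast
  show ?case
  proof (intro exI[of _ "c + 4"] allI impI)
    fix m :: nat assume m: "1 \<le> m"
    from c[OF m] obtain T where T: "T \<subseteq> {0..<2 ^ (c * m)}" "card T = m ^ (s - 1)" "weak_free s id T"
      by blast
    define M :: int where "M = 2 ^ (c * m)"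
    have TM: "T \<subseteq> {0..<M}" and "0 < M" using T by (simp_all add: M_def)
    define Y :: "int set" where "Y = (\<lambda>a. 2 ^ m - 2 ^ a) ` {..<m}"
    have Ypow: "2 ^ m - y \<in> range (\<lambda>a. 2 ^ a)" if "y \<in> Y" for y
      using that by (auto simp: Y_def)
    have "card Y = m"
      unfolding Y_def by (subst card_image) (auto simp: inj_on_def)
    have "Y \<subseteq> {0..<2 ^ m}"
      by (auto simp: Y_def intro!: power_increasing)
    let ?A = "two_scale M Y T"
    have "4 * M * 2 ^ m = 2 ^ (2 + c * m + m)"
      by (simp add: M_def power_add)
    also have "\<dots> \<le> 2 ^ ((c + 4) * m)"
      using m by (intro power_increasing) (auto simp: algebra_simps)
    finally have "?A \<subseteq> {0..<2 ^ ((c + 4) * m)}"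
      using two_scale_bounds[OF TM \<open>Y \<subseteq> _\<close>] by auto
    moreover have "card ?A = m ^ (Suc s - 1)"
      using card_two_scale[OF TM, of Y] T(2) \<open>card Y = m\<close> step.hyps
      by (simp flip: power_Suc)
    moreover have "weak_free (Suc s) id ?A"
      unfolding weak_free_def
    proof (intro allI impI notI)
      fix x assume x: "weak_wave (Suc s) id x" and "x ` {1..Suc s + 1} \<subseteq> ?A"
      then have xA: "x i \<in> ?A" if "1 \<le> i" "i \<le> Suc (Suc s)" for i using that by auto
      define y where "y = (\<lambda>i. x i div (4 * M))"
      have yY: "y i \<in> Y" if "1 \<le> i" "i \<le> Suc (Suc s)" for i
        unfolding y_def using two_scale_div(1)[OF TM xA[OF that]] .
      have y_le: "y i \<le> y (Suc i)" if "1 \<le> i" "i \<le> Suc s" for i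
      proof -
        have "0 < gap x i"
          using x that unfolding weak_wave_def by simp
        then show ?thesis
          unfolding y_def using \<open>0 < M\<close> by (intro zdiv_mono1) (auto simp: gap_def)
      qed
      \<comment> \<open>Only the first \<open>s\<close> gaps are searched for a jump, so that the
        jump is followed by a further gap.\<close>
      have "(\<forall>i\<in>{1..Suc s}. y i = y 1) \<or> (\<exists>j. 1 \<le> j \<and> j < Suc s \<and> 0 < gap y j)"
        using y_le by (intro jump_or_constant) auto
      then show False
      proof
        assume eq: "\<forall>i\<in>{1..Suc s}. y i = y 1"
        have "weak_wave s id (\<lambda>i. x i - 4 * M * y 1)"
          using x by (subst weak_wave_translate) (auto simp: weak_wave_def)
        moreover have "x i - 4 * M * y 1 \<in> T" if "i \<in> {1..s + 1}" for i
        proof -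
          have "x i - 4 * M * y i \<in> T"
            unfolding y_def using two_scale_div(2)[OF TM xA] that by auto
          then show ?thesis using bspec[OF eq, of i] that by simp
        qed
        ultimately show False
          using T(3) by (auto simp: weak_free_def image_subset_iff)
      next
        assume "\<exists>j. 1 \<le> j \<and> j < Suc s \<and> 0 < gap y j"
        then obtain j where j: "1 \<le> j" "j \<le> s" "0 < gap y j" by auto
        have "gap x j \<le> gap x (Suc j)"
          using x j by (auto simp: weak_wave_def)
        then have le: "gap y j \<le> gap y (Suc j)"
          unfolding y_def using two_scale_gap_mono[OF TM xA xA xA xA] j by simp
        define q where "q = (\<lambda>i. 2 ^ m - y i)"
        have q: "q i \<in> range (\<lambda>a. 2 ^ a)" if "1 \<le> i" "i \<le> Suc (Suc s)" for i
          unfolding q_def using Ypow[OF yY[OF that]] .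
        \<comment> \<open>A jump at least halves the distance \<open>q\<close> to
          \<open>2 ^ m\<close>. As the distance stays positive, what is left is too short for a next
          gap of at least the same size.\<close>
        have "q (Suc j) \<le> q j - q (Suc j)"
          using j by (intro powers_of_two_gap q) (auto simp: q_def gap_def)
        moreover have "0 < q (Suc (Suc j))"
          using q[of "Suc (Suc j)"] j by auto
        ultimately show False
          using le by (simp add: q_def gap_def)
      qed
    qed
    ultimately show "\<exists>A\<subseteq>{0..<2 ^ ((c + 4) * m)}. card A = m ^ (Suc s - 1) \<and> weak_free (Suc s) id A"
      by blast
  qed
qed

section \<open>Combining one layer with a set that avoids the tail\<close>

lemma weak_free_two_scale:
  assumes T: "weak_free k (\<lambda>j. f (s + j)) T" "T \<subseteq> {0..<M}"
    and f: "1 \<le> s" "strict_mono_on {1..s} f" "\<forall>i\<in>{1..s}. \<forall>j\<in>{1..k}. f (s + j) < f i"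
    and Y: "if s = 1 then Y \<subseteq> range (\<lambda>a. 2 ^ a) else weak_free s id Y"
  shows "weak_free (s + k) f (two_scale M Y T)"
  unfolding weak_free_def
proof (intro allI impI notI)
  let ?A = "two_scale M Y T"
  fix x assume x: "weak_wave (s + k) f x" and sub: "x ` {1..s + k + 1} \<subseteq> ?A"
  then have xA: "x i \<in> ?A" if "1 \<le> i" "i \<le> Suc (s + k)" for i using that by auto
  have "0 < M"
    using T(2) two_scale_div(2)[OF T(2) xA[of 1]] by fastforce
  define y where "y = (\<lambda>i. x i div (4 * M))"
  have yY: "y i \<in> Y" if "1 \<le> i" "i \<le> Suc (s + k)" for i
    unfolding y_def using two_scale_div(1)[OF T(2) xA[OF that]] .
  have y_le: "y i \<le> y (Suc i)" if "1 \<le> i" "i \<le> s + k" for i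
    proof -
      have "0 < gap x i"
        using x that unfolding weak_wave_def by simp
      then show ?thesis
        unfolding y_def using \<open>0 < M\<close> by (intro zdiv_mono1) (auto simp: gap_def)
    qed
  have "(\<forall>i\<in>{Suc s..Suc (s + k)}. y i = y (Suc s)) \<or> (\<exists>j. Suc s \<le> j \<and> j < Suc (s + k) \<and> 0 < gap y j)"
    using y_le by (intro jump_or_constant) auto
  then show False
  proof
    assume eq: "\<forall>i\<in>{Suc s..Suc (s + k)}. y i = y (Suc s)"
    have "weak_wave k (\<lambda>j. f (s + j)) (\<lambda>j. x (s + j) - 4 * M * y (Suc s))"
      using weak_wave_tail[OF x] by (subst weak_wave_translate)
    moreover have "x (s + j) - 4 * M * y (Suc s) \<in> T" if "j \<in> {1..k + 1}" for j
    proof -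
      have "x (s + j) - 4 * M * y (s + j) \<in> T"
        unfolding y_def using two_scale_div(2)[OF T(2) xA] that by auto
      then show ?thesis using bspec[OF eq, of "s + j"] that by simp
    qed
    ultimately show False
      using T(1) by (auto simp: weak_free_def image_subset_iff)
  next
    assume "\<exists>j. Suc s \<le> j \<and> j < Suc (s + k) \<and> 0 < gap y j"
    then obtain j where j: "Suc s \<le> j" "j \<le> s + k" "0 < gap y j" by auto
    \<comment> \<open>Head values exceed tail values, so a single jump in the tail forces a jump of
      at least that size in every head gap.\<close>
    have big: "gap y j \<le> gap y i" if i: "i \<in> {1..s}" for i
    proof -
      have "f j < f i"
        using bspec[OF bspec[OF f(3) i], of "j - s"] j by (simp add: Suc_le_eq)
      then have "gap x j \<le> gap x i"
        using x i j by (auto simp: weak_wave_def)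
      then show ?thesis
        unfolding y_def using two_scale_gap_mono[OF T(2) xA xA xA xA] i j by simp
    qed
    show False
    proof (cases "s = 1")
      case True
      then have pow: "y i \<in> range (\<lambda>a. 2 ^ a)" if "1 \<le> i" "i \<le> Suc (s + k)" for i
        using Y yY[OF that] by auto
      \<comment> \<open>Among powers of two a jump from \<open>y j\<close> has size at least
        \<open>y j\<close>, hence at least \<open>y 2\<close>, which exceeds the first gap
        \<open>y 2 - y 1\<close>.\<close>
      have "y 2 \<le> y j"
      proof (rule mono_chain)
        show "y i \<le> y (Suc i)" if "2 \<le> i" "i < j" for i
          using that j by (intro y_le) auto
        show "2 \<le> j"
          using j True by simp
      qed
      moreover have "y j \<le> gap y j"
        unfolding gap_def using j by (intro powers_of_two_gap pow) (auto simp: gap_def)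
      moreover have "gap y j \<le> y 2 - y 1"
        using big[of 1] True by (simp add: gap_def numeral_2_eq_2)
      moreover have "0 < y 1"
        using pow[of 1] by auto
      ultimately show False by simp
    next
      case False
      \<comment> \<open>All head gaps of the projection are positive, so it is a weak wave with
        \<open>s\<close> weakly increasing gaps, which \<open>Y\<close> excludes.\<close>
      have "weak_wave s id x"
        using weak_wave_increasing[OF f(2)] weak_wave_restrict[OF x] by blast
      then have "gap x i' \<le> gap x i" if "i \<in> {1..s}" "i' \<in> {1..s}" "i' < i" for i i'
        using that unfolding weak_wave_def id_apply by blast
      then have "gap y i' \<le> gap y i" if "i \<in> {1..s}" "i' \<in> {1..s}" "i' < i" for i i'
        unfolding y_def using two_scale_gap_mono[OF T(2) xA xA xA xA] that by simp
      moreover have "0 < gap y i" if "i \<in> {1..s}" for i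
        using big[OF that] j(3) by simp
      ultimately have "weak_wave s id y"
        unfolding weak_wave_def id_apply by blast
      moreover have "y ` {1..s + 1} \<subseteq> Y"
        using yY by auto
      ultimately show False
        using Y False by (auto simp: weak_free_def)
    qed
  qed
qed

text \<open>Under \<open>two_scale\<close> cardinalities multiply and logarithms of lengths add, so
  the logarithm of the length stays linear in \<open>m\<close> while each layer multiplies the size
  by its own power of \<open>m\<close>.\<close>

lemma weak_free_sets:
  assumes "layer_exponent k f e"
  shows "\<exists>c. \<forall>m\<ge>1. \<exists>A. A \<subseteq> {0..<2 ^ (c * m)} \<and> card A = m ^ e \<and> weak_free k f A"
  using assms
proof (induction rule: layer_exponent.induct)
  case (single s f)
  then show ?case
    using weak_free_increasing_sets[OF single(1)] weak_free_increasing[OF single(2)] by simp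
next
  case (layer s f k e)
  let ?d = "if s = 1 then 1 else s - 1"
  from layer.IH obtain c where c: "\<And>m. m \<ge> 1 \<Longrightarrow>
      \<exists>A. A \<subseteq> {0..<2 ^ (c * m)} \<and> card A = m ^ e \<and> weak_free k (\<lambda>j. f (s + j)) A"
    by auto
  have "\<exists>c. \<forall>m\<ge>1. \<exists>Y. Y \<subseteq> {0..<2 ^ (c * m)} \<and> card Y = m ^ ?d \<and>
     (if s = 1 then Y \<subseteq> range (\<lambda>a. 2 ^ a) else weak_free s id Y)"
  proof (cases "s = 1")
    case True
    have Y: "(\<lambda>a. 2 ^ a :: int) ` {..<m} \<subseteq> {0..<2 ^ (1 * m)} \<and> card ((\<lambda>a. 2 ^ a :: int) ` {..<m}) = m ^ ?d" for m
      using True by (subst card_image) (auto simp: inj_on_def)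
    show ?thesis
    proof (intro exI[of _ 1] allI impI)
      fix m :: nat
      show "\<exists>Y\<subseteq>{0..<2 ^ (1 * m)}. card Y = m ^ ?d \<and>
          (if s = 1 then Y \<subseteq> range (\<lambda>a. 2 ^ a) else weak_free s id Y)"
        using Y[of m] True by (intro exI[of _ "(\<lambda>a. 2 ^ a) ` {..<m}"]) auto
    qed
  next
    case False
    then show ?thesis using weak_free_increasing_sets[OF layer(1)] by simp
  qed
  then obtain c' where c': "\<And>m. m \<ge> 1 \<Longrightarrow> \<exists>Y. Y \<subseteq> {0..<2 ^ (c' * m)} \<and> card Y = m ^ ?d \<and>
     (if s = 1 then Y \<subseteq> range (\<lambda>a. 2 ^ a) else weak_free s id Y)"
    by blast
  show ?case
  \<comment> \<open>The summand 2 absorbs the factor 4 of \<open>two_scale\<close>, as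
    \<open>1 \<le> m\<close>.\<close>
  proof (intro exI[of _ "c + c' + 2"] allI impI)
    fix m :: nat assume m: "1 \<le> m"
    from c[OF m] obtain T where T: "T \<subseteq> {0..<2 ^ (c * m)}" "card T = m ^ e"
        "weak_free k (\<lambda>j. f (s + j)) T"
      by blast
    from c'[OF m] obtain Y where Y: "Y \<subseteq> {0..<2 ^ (c' * m)}" "card Y = m ^ ?d"
        "if s = 1 then Y \<subseteq> range (\<lambda>a. 2 ^ a) else weak_free s id Y"
      by blast
    let ?A = "two_scale (2 ^ (c * m)) Y T"
    have "4 * 2 ^ (c * m) * 2 ^ (c' * m) = (2 :: int) ^ (2 + c * m + c' * m)"
      by (simp add: power_add)
    also have "\<dots> \<le> 2 ^ ((c + c' + 2) * m)"
      using m by (intro power_increasing) (auto simp: algebra_simps)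
    finally have "?A \<subseteq> {0..<2 ^ ((c + c' + 2) * m)}"
      using two_scale_bounds[OF T(1) Y(1)] by auto
    moreover have "card ?A = m ^ (?d + e)"
      unfolding card_two_scale[OF T(1)] T(2) Y(2) by (simp add: power_add)
    moreover have "weak_free (s + k) f ?A"
      using weak_free_two_scale T Y layer by blast
    ultimately show "\<exists>A\<subseteq>{0..<2 ^ ((c + c' + 2) * m)}. card A = m ^ (?d + e) \<and> weak_free (s + k) f A"
      by blast
  qed
qed

section \<open>Upper bounds for wave-free sets\<close>

lemma card_le_by_scale:
  fixes A :: "int set"
  assumes "finite A" "\<And>y. y \<in> A \<Longrightarrow> y \<noteq> z \<Longrightarrow> h y < N"
    and "\<And>i. i < N \<Longrightarrow> card {y \<in> A. y \<noteq> z \<and> h y = i} \<le> B"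
  shows "card A \<le> 1 + N * B"
proof -
  have "A \<subseteq> insert z (\<Union>i<N. {y \<in> A. y \<noteq> z \<and> h y = i})"
    using assms(2) by auto
  then have "card A \<le> card (insert z (\<Union>i<N. {y \<in> A. y \<noteq> z \<and> h y = i}))"
    using assms(1) by (intro card_mono) auto
  also have "\<dots> \<le> 1 + card (\<Union>i<N. {y \<in> A. y \<noteq> z \<and> h y = i})"
    by (simp add: card_insert_le_m1 card_insert_if)
  also have "card (\<Union>i<N. {y \<in> A. y \<noteq> z \<and> h y = i}) \<le> (\<Sum>i<N. card {y \<in> A. y \<noteq> z \<and> h y = i})"
    by (rule card_UN_le) auto
  also have "\<dots> \<le> (\<Sum>i<N. B)"
    using assms(3) by (intro sum_mono) auto
  finally show ?thesis by simp
qed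

text \<open>The floor of the binary logarithm for positive \<open>d\<close>; for other
  \<open>d\<close> the value is arbitrary.\<close>

definition dyadic_scale :: "int \<Rightarrow> nat" where
  "dyadic_scale d = (SOME i. 2 ^ i \<le> d \<and> d < 2 ^ Suc i)"

lemma dyadic_scale:
  assumes "0 < d"
  shows "2 ^ dyadic_scale d \<le> d" "d < 2 ^ Suc (dyadic_scale d)"
proof -
  obtain i where "2 ^ i \<le> nat d" "nat d < 2 ^ Suc i"
    using ex_power_ivl1[of 2 "nat d"] assms by (metis Suc_eq_plus1 Suc_leI One_nat_def order_refl zero_less_nat_eq)
  then have "2 ^ i \<le> d \<and> d < 2 ^ Suc i"
    using assms by (auto simp: le_nat_iff nat_less_iff simp del: power_Suc)
  then have "2 ^ dyadic_scale d \<le> d \<and> d < 2 ^ Suc (dyadic_scale d)"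
    unfolding dyadic_scale_def by (rule someI)
  then show "2 ^ dyadic_scale d \<le> d" "d < 2 ^ Suc (dyadic_scale d)" by auto
qed

lemma dyadic_scale_less:
  assumes "0 < d" "d < 2 ^ N"
  shows "dyadic_scale d < N"
proof -
  have "(2::int) ^ dyadic_scale d < 2 ^ N"
    using dyadic_scale(1)[OF assms(1)] assms(2) by linarith
  then show ?thesis by simp
qed

text \<open>The left end \<open>a\<close> is arbitrary because the inductions apply the bound to
  pieces of a set; \<open>N + 1\<close> keeps the bound meaningful for a single point, where
  \<open>N = 0\<close>.\<close>

definition bounded_by :: "nat \<Rightarrow> (nat \<Rightarrow> nat) \<Rightarrow> nat \<Rightarrow> nat \<Rightarrow> bool" where
  "bounded_by k f C e \<longleftrightarrow> (\<forall>N a A. A \<subseteq> {a..<a + 2 ^ N} \<longrightarrow> \<not> contains_wave k f A \<longrightarrow>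
     card A \<le> C * (N + 1) ^ e)"

lemma bounded_byD:
  assumes "bounded_by k f C e" "A \<subseteq> {a..<a + 2 ^ N}" "C * (N + 1) ^ e < card A"
  shows "contains_wave k f A"
  using assms unfolding bounded_by_def by (meson not_le)

section \<open>Increasing patterns and leading layers of size one\<close>

lemma card_le_1_no_pair:
  fixes A :: "int set"
  assumes "finite A" "\<not> contains_wave 1 id A"
  shows "card A \<le> 1"
proof -
  have "x = y" if "x \<in> A" "y \<in> A" for x y
  proof (rule ccontr)
    assume "x \<noteq> y"
    define w where "w = (\<lambda>i::nat. if i = 1 then min x y else max x y)"
    have "wave 1 id w"
      using \<open>x \<noteq> y\<close> by (auto simp: wave_gap_iff gap_def w_def)
    moreover have "w ` {1..1 + 1} \<subseteq> A"
      using that by (auto simp: w_def min_def max_def)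
    ultimately show False
      using assms(2) by (auto simp: contains_wave_def)
  qed
  then show ?thesis
    using assms(1) by (simp add: card_le_Suc0_iff_eq)
qed

text \<open>The set is split dyadically by the distance to its maximum \<open>z\<close>. Points at
  distance between \<open>2 ^ i\<close> and \<open>2 ^ (i + 1)\<close> have mutual gaps below
  \<open>2 ^ i\<close>, so appending \<open>z\<close> to a wave among them adds a new largest gap at
  the end.\<close>

lemma bounded_by_increasing:
  assumes "1 \<le> s"
  shows "bounded_by s id 1 (s - 1)"
  using assms
proof (induction s rule: dec_induct)
  case base
  then show ?case
    unfolding bounded_by_def using card_le_1_no_pair
    by (metis diff_self_eq_0 finite_atLeastLessThan_int finite_subset mult_1 power_0)
next
  case (step s)
  show ?case
    unfolding bounded_by_def
  proof (intro allI impI)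
    fix N a and A :: "int set"
    assume A: "A \<subseteq> {a..<a + 2 ^ N}" and no: "\<not> contains_wave (Suc s) id A"
    have fin: "finite A" using A finite_subset by blast
    show "card A \<le> 1 * (N + 1) ^ (Suc s - 1)"
    proof (cases "A = {}")
      case False
      define z where "z = Max A"
      have z: "z \<in> A" "\<And>y. y \<in> A \<Longrightarrow> y \<le> z"
        using fin False by (auto simp: z_def)
      have "card A \<le> 1 + N * N ^ (s - 1)"
      proof (rule card_le_by_scale[OF fin, of z "\<lambda>y. dyadic_scale (z - y)"])
        fix y assume "y \<in> A" "y \<noteq> z"
        moreover have "a \<le> y" "z < a + 2 ^ N"
          using A z(1) \<open>y \<in> A\<close> by auto
        ultimately show "dyadic_scale (z - y) < N"
          using z(2)[of y] by (intro dyadic_scale_less) auto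
      next
        fix i assume i: "i < N"
        let ?D = "{y \<in> A. y \<noteq> z \<and> dyadic_scale (z - y) = i}"
        have D: "2 ^ i \<le> z - y" "z - y < 2 * 2 ^ i" if "y \<in> ?D" for y
          using dyadic_scale[of "z - y"] z(2)[of y] that by auto
        have "?D \<subseteq> {z - 2 * 2 ^ i + 1..<(z - 2 * 2 ^ i + 1) + 2 ^ i}"
          using D by force
        moreover have "\<not> contains_wave s id ?D"
        proof
          assume "contains_wave s id ?D"
          then obtain x where x: "wave s id x" "x ` {1..s + 1} \<subseteq> ?D"
            by (auto simp: contains_wave_def)
          define w where "w = x(Suc (Suc s) := z)"
          have gw: "gap w i = gap x i" if "i \<in> {1..s}" for i
            using that by (auto simp: gap_def w_def)
          have xD: "2 ^ i \<le> z - x j" "z - x j < 2 * 2 ^ i" if "j \<in> {1..Suc s}" for j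
          proof -
            have "x j \<in> ?D"
              using x(2) imageI[OF that, of x] by auto
            from D[OF this] show "2 ^ i \<le> z - x j" "z - x j < 2 * 2 ^ i" .
          qed
          have last: "2 ^ i \<le> gap w (Suc s)"
            using xD[of "Suc s"] by (simp add: gap_def w_def)
          have "wave (Suc s) id w"
          proof (rule wave_idI)
            fix j assume "j \<in> {1..Suc s}"
            then show "0 < gap w j"
              using gw[of j] x(1) less_le_trans[OF _ last] by (cases "j = Suc s") (auto simp: wave_gap_iff)
          next
            fix j assume j: "1 \<le> j" "j < Suc s"
            show "gap w j < gap w (Suc j)"
            proof (cases "j = s")
              case True
              have "gap x s < 2 ^ i"
                using xD[of s] xD[of "Suc s"] True j by (simp add: gap_def)
              then show ?thesis
                using gw[of s] last True j by simp
            next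
              case False
              then show ?thesis
                using gw[of j] gw[of "Suc j"] x(1) j by (auto simp: wave_gap_iff)
            qed
          qed
          moreover have "w ` {1..Suc s + 1} \<subseteq> A"
            using x(2) z(1) by (auto simp: w_def le_Suc_eq image_subset_iff)
          ultimately show False
            using no by (auto simp: contains_wave_def)
        qed
        ultimately have "card ?D \<le> 1 * (i + 1) ^ (s - 1)"
          using step.IH unfolding bounded_by_def by blast
        \<comment> \<open>Since \<open>i < N\<close>, the base can be \<open>N\<close> instead of
          \<open>N + 1\<close>; this leaves room for the extra point \<open>z\<close> in
          \<open>(N + 1) ^ s\<close>.\<close>
        also have "\<dots> \<le> N ^ (s - 1)"
          using i by (simp add: power_mono)
        finally show "card ?D \<le> N ^ (s - 1)" .
      qed
      also have "\<dots> = 1 + N ^ s"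
        using step.hyps by (cases s) auto
      also have "\<dots> \<le> (N + 1) ^ s"
      proof -
        obtain t where "s = Suc t"
          using step.hyps by (cases s) auto
        moreover have "1 + N * N ^ t \<le> (N + 1) ^ t + N * (N + 1) ^ t"
          by (intro add_mono mult_left_mono power_mono one_le_power) auto
        ultimately show ?thesis by simp
      qed
      finally show ?thesis by simp
    qed simp
  qed
qed

text \<open>A tail found among the points at distance between \<open>2 ^ i\<close> and
  \<open>2 ^ (i + 1)\<close> from the minimum has all gaps below \<open>2 ^ i\<close>. Putting the
  minimum in front creates a first gap of at least \<open>2 ^ i\<close>, which is the layer.\<close>

lemma bounded_by_layer_1:
  assumes tail: "bounded_by k (\<lambda>j. f (1 + j)) C e"
    and f: "\<forall>j\<in>{1..k}. f (1 + j) < f 1"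
  shows "bounded_by (1 + k) f (C + 1) (1 + e)"
  unfolding bounded_by_def
proof (intro allI impI)
  fix N a and A :: "int set"
  assume A: "A \<subseteq> {a..<a + 2 ^ N}" and no: "\<not> contains_wave (1 + k) f A"
  have fin: "finite A" using A finite_subset by blast
  show "card A \<le> (C + 1) * (N + 1) ^ (1 + e)"
  proof (cases "A = {}")
    case False
    define z where "z = Min A"
    have z: "z \<in> A" "\<And>y. y \<in> A \<Longrightarrow> z \<le> y"
      using fin False by (auto simp: z_def)
    have "card A \<le> 1 + N * (C * N ^ e)"
    proof (rule card_le_by_scale[OF fin, of z "\<lambda>y. dyadic_scale (y - z)"])
      fix y assume "y \<in> A" "y \<noteq> z"
      moreover have "a \<le> z" "y < a + 2 ^ N"
        using A z(1) \<open>y \<in> A\<close> by auto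
      ultimately show "dyadic_scale (y - z) < N"
        using z(2)[of y] by (intro dyadic_scale_less) auto
    next
      fix i assume i: "i < N"
      let ?D = "{y \<in> A. y \<noteq> z \<and> dyadic_scale (y - z) = i}"
      have D: "2 ^ i \<le> y - z" "y - z < 2 * 2 ^ i" if "y \<in> ?D" for y
        using dyadic_scale[of "y - z"] z(2)[of y] that by auto
      have "?D \<subseteq> {z + 2 ^ i..<(z + 2 ^ i) + 2 ^ i}"
        using D by force
      moreover have "\<not> contains_wave k (\<lambda>j. f (1 + j)) ?D"
      proof
        assume "contains_wave k (\<lambda>j. f (1 + j)) ?D"
        then obtain x where x: "wave k (\<lambda>j. f (1 + j)) x" "x ` {1..k + 1} \<subseteq> ?D"
          by (auto simp: contains_wave_def)
        define w where "w = (\<lambda>j. if j \<le> 1 then z else x (j - 1))"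
        have xD: "2 ^ i \<le> x j - z" "x j - z < 2 * 2 ^ i" if "j \<in> {1..Suc k}" for j
        proof -
          have "x j \<in> ?D"
            using x(2) imageI[OF that, of x] by auto
          from D[OF this] show "2 ^ i \<le> x j - z" "x j - z < 2 * 2 ^ i" .
        qed
        have first: "2 ^ i \<le> gap w 1"
          using xD[of 1] by (simp add: gap_def w_def)
        have "wave (1 + k) f w"
        proof (rule wave_joinI)
          show "wave 1 id w"
            using less_le_trans[OF _ first] by (simp add: wave_gap_iff)
          show "wave k (\<lambda>j. f (1 + j)) (\<lambda>j. w (1 + j))"
            using x(1) by (simp add: wave_gap_iff gap_def w_def)
          fix j assume j: "j \<in> {1..k}"
          have "gap w (1 + j) \<le> x (Suc k) - x 1"
            using wave_gap_le_diam[OF x(1) j] j by (simp add: gap_def w_def)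
          also have "\<dots> < 2 ^ i"
            using xD[of 1] xD[of "Suc k"] by simp
          finally show "gap w (1 + j) < gap w 1"
            using first by simp
        qed (use f in \<open>auto simp: strict_mono_on_def\<close>)
        moreover have "w j \<in> A" if "j \<in> {1..1 + k + 1}" for j
        proof (cases "j = 1")
          case False
          then have "x (j - 1) \<in> ?D"
            using x(2) that by (intro subsetD[OF x(2)] imageI) auto
          then show ?thesis using False that by (simp add: w_def)
        qed (use z in \<open>simp add: w_def\<close>)
        ultimately show False
          using no by (auto simp: contains_wave_def)
      qed
      ultimately have "card ?D \<le> C * (i + 1) ^ e"
        using tail unfolding bounded_by_def by blast
      also have "\<dots> \<le> C * N ^ e"
        using i by (simp add: power_mono)
      finally show "card ?D \<le> C * N ^ e" .
    qed
    also have "\<dots> = 1 + C * N ^ (1 + e)"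
      by simp
    also have "\<dots> \<le> (N + 1) ^ (1 + e) + C * (N + 1) ^ (1 + e)"
      by (intro add_mono mult_left_mono power_mono one_le_power) auto
    finally show ?thesis by (simp add: algebra_simps)
  qed simp
qed


section \<open>Leading layers of size at least two\<close>

lemma div_mod_5_separated:
  fixes p q U :: int
  assumes "0 < U" "p + U \<le> q" "p div U mod 5 = q div U mod 5"
  shows "4 * U < q - p"
proof -
  have "p div U + 1 \<le> q div U"
    using zdiv_mono1[OF assms(2,1)] assms(1) by simp
  \<comment> \<open>The quotients are distinct and congruent modulo 5, hence at least 5 apart;
    rounding costs less than one further \<open>U\<close>.\<close>
  moreover have "5 dvd q div U - p div U"
    using assms(3) by (metis mod_eq_dvd_iff)
  ultimately have "5 \<le> q div U - p div U"
    by (intro zdvd_imp_le) auto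
  then have "U * 5 \<le> U * (q div U - p div U)"
    using assms(1) by (intro mult_left_mono) auto
  moreover have "U * (q div U) \<le> q" "p < U * (p div U) + U"
    using mult_div_mod_eq[of U q] pos_mod_sign[OF assms(1), of q]
      mult_div_mod_eq[of U p] pos_mod_bound[OF assms(1), of p] by linarith+
  ultimately show ?thesis
    by (simp add: right_diff_distrib)
qed

text \<open>The points \<open>x 1, \<dots>, x s\<close> are left ends of chunks of length about \<open>U\<close>, and \<open>p\<close> is the right
  end of the chunk at \<open>x 1\<close>; the tail \<open>y\<close> lies in the chunk at \<open>x s\<close>, which is dropped.\<close>

lemma wave_insert_second:
  assumes s: "2 \<le> s" and U: "0 < U"
    and x: "wave (s - 1) id x" "4 * U < gap x 1"
    and p: "U \<le> p - x 1" "p - x 1 < 2 * U"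
    and f: "strict_mono_on {1..s} f" "\<forall>i\<in>{1..s}. \<forall>j\<in>{1..k}. f (s + j) < f i"
    and y: "wave k (\<lambda>j. f (s + j)) y" "x s \<le> y 1" "y (Suc k) - y 1 < U"
  shows "wave (s + k) f (\<lambda>i. if i = 1 then x 1 else if i = 2 then p else
    if i \<le> s then x (i - 1) else y (i - s))"
    (is "wave _ f ?w")
proof -
  \<comment> \<open>The point \<open>x s\<close> is moved right to the start of the tail. This can
    only lengthen the last gap, so the gaps still increase.\<close>
  define x' where "x' = (\<lambda>i. if i < s then x i else y 1)"
  have x'_gap: "gap x' i = gap x i" if "Suc i < s" for i
    using that by (simp add: gap_def x'_def)
  have x'_last: "gap x (s - 1) \<le> gap x' (s - 1)"
    using y(2) s by (simp add: gap_def x'_def)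
  have x'_incr: "gap x' i < gap x' (Suc i)" if "1 \<le> i" "Suc i < s" for i
  proof -
    have "gap x i < gap x (Suc i)"
      using x(1) that by (auto simp: wave_gap_iff)
    also have "\<dots> \<le> gap x' (Suc i)"
      using x'_last x'_gap[of "Suc i"] that by (cases "Suc i = s - 1") auto
    finally show ?thesis using x'_gap that by simp
  qed
  have x'_1: "gap x 1 \<le> gap x' 1"
    using x'_last x'_gap[of 1] s by (cases "s = 2") auto
  have w_1: "gap ?w 1 = p - x 1"
    by (simp add: gap_def)
  \<comment> \<open>Inserting \<open>p\<close> splits the first gap of \<open>x'\<close>, which is
    above \<open>4 * U\<close>, into a piece below \<open>2 * U\<close> and a remainder above
    \<open>2 * U\<close>. The remainder is still shorter than any later head gap.\<close>
  have w_2: "gap ?w 2 = gap x' 1 - (p - x 1)"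
    using s by (cases "s = 2") (auto simp: gap_def x'_def numeral_2_eq_2)
  have w_ge_3: "gap ?w (Suc i) = gap x' i" if "2 \<le> i" "i < s" for i
    using that by (cases "s = Suc i") (auto simp: gap_def x'_def)
  have x'_big: "4 * U < gap x' i" if "1 \<le> i" "i < s" for i
    using that
  proof (induction i rule: dec_induct)
    case base
    then show ?case using x'_1 x(2) by simp
  next
    case (step i)
    then show ?case using x'_incr[of i] by simp
  qed
  show ?thesis
  proof (rule wave_joinI)
    show "wave s id ?w"
    proof (rule wave_idI)
      fix i assume i: "i \<in> {1..s}"
      consider "i = 1" | "i = 2" | j where "i = Suc j" "2 \<le> j" "j < s"
        using i by (cases i) force+
      then show "0 < gap ?w i"
      proof cases
        case 1 then show ?thesis using w_1 p U by simp
      next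
        case 2 then show ?thesis using w_2 x'_big[of 1] s p U by simp
      next
        case 3 then show ?thesis using w_ge_3 x'_big[of j] U by simp
      qed
    next
      fix i assume i: "1 \<le> i" "i < s"
      consider "i = 1" | "i = 2" | j where "i = Suc j" "2 \<le> j" "j < s"
        using i by (cases i) force+
      then show "gap ?w i < gap ?w (Suc i)"
      proof cases
        case 1
        then have "Suc i = 2" by simp
        then show ?thesis
          using w_1 w_2 x'_big[of 1] s p 1 by (simp del: One_nat_def)
      next
        case 2
        then show ?thesis
          using w_2 w_ge_3[of 2] x'_incr[of 1] i p U by (simp add: numeral_2_eq_2)
      next
        case 3
        then show ?thesis
          using w_ge_3[of j] w_ge_3[of "Suc j"] x'_incr[of j] i by simp
      qed
    qed
  next
    have "wave k (\<lambda>j. f (s + j)) (\<lambda>j. ?w (s + j)) \<longleftrightarrow> wave k (\<lambda>j. f (s + j)) y"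
      using s by (auto simp: wave_gap_iff gap_def)
    then show "wave k (\<lambda>j. f (s + j)) (\<lambda>j. ?w (s + j))"
      using y(1) by blast
  next
    fix j assume j: "j \<in> {1..k}"
    have "gap ?w (s + j) = gap y j"
      using s j by (auto simp: gap_def Suc_diff_le)
    also have "\<dots> < gap ?w 1"
      using wave_gap_le_diam[OF y(1) j] y(3) w_1 p by simp
    finally show "gap ?w (s + j) < gap ?w 1" .
  qed (use f in auto)
qed

lemma pigeonhole_color:
  assumes "finite J" "finite S" "color ` J \<subseteq> S" "card S * H < card J"
  shows "\<exists>c. H < card {j \<in> J. color j = c}"
proof (rule ccontr)
  assume "\<not> ?thesis"
  then have "(\<Sum>c\<in>S. card {j \<in> J. color j = c}) \<le> (\<Sum>c\<in>S. H)"
    by (intro sum_mono) (auto simp: not_less)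
  moreover have "(\<Sum>c\<in>S. card {j \<in> J. color j = c}) = card J"
    using sum.group[OF assms(1,2,3), of "\<lambda>_. 1 :: nat"] by simp
  ultimately show False
    using assms(4) by simp
qed

lemma bounded_by_layer_2:
  assumes tail: "bounded_by k (\<lambda>j. f (s + j)) C e"
    and s: "2 \<le> s"
    and f: "strict_mono_on {1..s} f" "\<forall>i\<in>{1..s}. \<forall>j\<in>{1..k}. f (s + j) < f i"
  shows "bounded_by (s + k) f (12 * (C + 1)) ((s - 1) + e)"
  unfolding bounded_by_def
proof (intro allI impI)
  fix N a and A :: "int set"
  assume A: "A \<subseteq> {a..<a + 2 ^ N}" and no: "\<not> contains_wave (s + k) f A"
  have fin: "finite A" using A finite_subset by blast
  \<comment> \<open>In the given range, \<open>m\<close> points force a tail and more than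
    \<open>H\<close> left ends force \<open>s - 1\<close> increasing gaps. The set is cut into
    \<open>K\<close> chunks of \<open>2 * m\<close> consecutive gaps; neighbouring chunks share an
    end point.\<close>
  define m where "m = C * (N + 1) ^ e + 1"
  define H where "H = (N + 1) ^ (s - 2)"
  define K where "K = (card A - 1) div (2 * m)"
  have m: "0 < m" by (simp add: m_def)
  have "K \<le> 5 * N * H"
  proof (rule ccontr)
    assume "\<not> K \<le> 5 * N * H"
    then have K: "5 * N * H < K" by simp
    define \<alpha> where "\<alpha> = (\<lambda>i. sorted_list_of_set A ! i)"
    have \<alpha>_less: "\<alpha> i < \<alpha> j" if "i < j" "j < card A" for i j
      using that strict_sorted_list_of_set[of A] fin
      by (auto simp: \<alpha>_def sorted_wrt_nth_less)
    have \<alpha>_le: "\<alpha> i \<le> \<alpha> j" if "i \<le> j" "j < card A" for i j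
      using \<alpha>_less that by (cases "i = j") (auto intro: less_imp_le)
    have \<alpha>_in: "\<alpha> i \<in> A" if "i < card A" for i
      using nth_mem[of i "sorted_list_of_set A"] that fin by (simp add: \<alpha>_def)
    define b where "b = (\<lambda>j. \<alpha> (2 * m * j))"
    have idx: "2 * m * j + 2 * m < card A" if "j < K" for j
    proof -
      have "2 * m * (j + 1) \<le> 2 * m * K"
        using that by (intro mult_le_mono2) simp
      also have "\<dots> \<le> card A - 1"
        unfolding K_def by (metis div_times_less_eq_dividend mult.commute)
      moreover have "0 < 2 * m * (j + 1)" "2 * m * (j + 1) = 2 * m * j + 2 * m"
        using m by simp_all
      ultimately show ?thesis by linarith
    qed
    have b_in: "b j \<in> A" "b (Suc j) \<in> A" if "j < K" for j
      using idx[OF that] \<alpha>_in by (auto simp: b_def algebra_simps)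
    have b_less: "b i < b j" if "i < j" "j \<le> K" for i j
    proof -
      from that have "0 < j" by simp
      then obtain j' where "j = Suc j'" using gr0_implies_Suc by blast
      moreover from this have "2 * m * j < card A"
        using that idx[of j'] by (simp add: algebra_simps)
      moreover have "2 * m * i < 2 * m * j"
        using that m by (intro mult_strict_left_mono) auto
      ultimately have "2 * m * i < 2 * m * j" "2 * m * j < card A"
        by blast+
      then show ?thesis using \<alpha>_less by (simp add: b_def)
    qed
    have b_le: "b i \<le> b j" if "i \<le> j" "j \<le> K" for i j
      using b_less that by (cases "i = j") (auto intro: less_imp_le)
    \<comment> \<open>The first \<open>m\<close> and the next \<open>m\<close> points of a chunk
      have spans adding up to less than its length, so the shorter span is below half of it.\<close>
    have half: "\<exists>B c d. B \<subseteq> A \<and> card B = m \<and> B \<subseteq> {c..c + d} \<and> b j \<le> c \<and> 2 * d < gap b j"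
      if j: "j < K" for j
    proof -
      define t where "t = 2 * m * j"
      have t: "t + 2 * m < card A" using idx[OF j] by (simp add: t_def)
      define B where "B = (\<lambda>i. \<alpha> ` {i..<i + m})"
      have B: "B i \<subseteq> A \<and> card (B i) = m \<and> B i \<subseteq> {\<alpha> i..\<alpha> i + (\<alpha> (i + m - 1) - \<alpha> i)}" if "i + m < card A" for i
      proof (intro conjI)
        show "B i \<subseteq> A" using \<alpha>_in that by (auto simp: B_def)
        have "inj_on \<alpha> {i..<i + m}"
          using \<alpha>_less that by (intro linorder_inj_onI) (auto simp: less_imp_neq)
        then show "card (B i) = m"
          by (simp add: B_def card_image)
        have "\<alpha> i \<le> \<alpha> l \<and> \<alpha> l \<le> \<alpha> (i + m - 1)" if "i \<le> l" "l < i + m" for l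
          using that \<open>i + m < card A\<close> by (intro conjI \<alpha>_le) auto
        then show "B i \<subseteq> {\<alpha> i..\<alpha> i + (\<alpha> (i + m - 1) - \<alpha> i)}"
          by (auto simp: B_def)
      qed
      have "\<alpha> (t + m - 1) < \<alpha> (t + m)" "\<alpha> (t + m + m - 1) < \<alpha> (t + 2 * m)" "\<alpha> t < \<alpha> (t + m)"
        using m t by (auto intro!: \<alpha>_less)
      moreover have "gap b j = \<alpha> (t + 2 * m) - \<alpha> t"
        by (simp add: gap_def b_def t_def algebra_simps)
      ultimately have "2 * (\<alpha> (t + m - 1) - \<alpha> t) < gap b j \<or>
          2 * (\<alpha> (t + m + m - 1) - \<alpha> (t + m)) < gap b j \<and> b j \<le> \<alpha> (t + m)"
        by (auto simp: b_def t_def)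
      moreover have "b j \<le> \<alpha> t" by (simp add: b_def t_def)
      ultimately show ?thesis
        using B[of t] B[of "t + m"] t by (metis add.assoc add_lessD1 mult_2)
    qed
    \<comment> \<open>The residue modulo 5 makes left ends of the same color more than \<open>4 * U\<close> apart.\<close>
    define color where "color = (\<lambda>j. (dyadic_scale (gap b j), b j div 2 ^ dyadic_scale (gap b j) mod 5))"
    have gap_pos: "0 < gap b j" if "j < K" for j
      using b_less[of j "Suc j"] that by (simp add: gap_def)
    have "dyadic_scale (gap b j) < N" if "j < K" for j
    proof (rule dyadic_scale_less[OF gap_pos[OF that]])
      have "a \<le> b j" "b (Suc j) < a + 2 ^ N"
        using b_in[OF that] A by auto
      then show "gap b j < 2 ^ N" by (simp add: gap_def)
    qed
    then have "color ` {..<K} \<subseteq> {..<N} \<times> {0..<5}"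
      by (auto simp: color_def)
    then have "\<exists>c. H < card {j \<in> {..<K}. color j = c}"
      using K by (intro pigeonhole_color) (auto simp: card_cartesian_product mult.commute)
    then obtain u r where "H < card {j \<in> {..<K}. color j = (u, r)}" by auto
    define J where "J = {j \<in> {..<K}. color j = (u, r)}"
    define U :: int where "U = 2 ^ u"
    have J: "j < K" "U \<le> gap b j" "gap b j < 2 * U" "b j div U mod 5 = r" if "j \<in> J" for j
      using that dyadic_scale[OF gap_pos[of j]] by (auto simp: J_def color_def U_def)
    have inj: "inj_on b J"
    proof (rule linorder_inj_onI)
      fix i j assume "i < j" "i \<in> J" "j \<in> J"
      then show "b i \<noteq> b j"
        using b_less[of i j] J(1)[of j] by simp
    qed auto
    \<comment> \<open>Only \<open>s - 1\<close> gaps are needed between left ends, so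
      \<open>H\<close> carries the exponent \<open>s - 2\<close>; the factor \<open>N\<close> for
      the scale raises this to \<open>s - 1\<close>.\<close>
    have "contains_wave (s - 1) id (b ` J)"
    proof (rule bounded_byD[OF bounded_by_increasing])
      show "b ` J \<subseteq> {a..<a + 2 ^ N}" using b_in J(1) A by blast
      have "H < card J"
        unfolding J_def by fact
      then have "H < card (b ` J)"
        by (simp only: card_image[OF inj])
      then show "1 * (N + 1) ^ (s - 1 - 1) < card (b ` J)"
        by (simp add: H_def numeral_2_eq_2)
    qed (use s in simp)
    then obtain x where x: "wave (s - 1) id x" "x ` {1..s - 1 + 1} \<subseteq> b ` J"
      by (auto simp: contains_wave_def)
    have x_in: "x i \<in> b ` J" if "1 \<le> i" "i \<le> s" for i
      using that x(2) s by (auto simp: image_subset_iff)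
    obtain j1 j2 jl where j: "j1 \<in> J" "x 1 = b j1" "j2 \<in> J" "x 2 = b j2" "jl \<in> J" "x s = b jl"
      using x_in[of 1] x_in[of 2] x_in[of s] s by auto
    have "x 1 < x 2"
      using x(1) s by (auto simp: wave_gap_iff gap_def numeral_2_eq_2)
    then have "j1 < j2"
      using b_le[of j2 j1] j J(1)[OF j(1)] by (cases "j1 < j2") auto
    have sep: "4 * U < gap x 1"
    proof -
      have "b j1 + U \<le> b (Suc j1)"
        using J(2)[OF j(1)] by (simp add: gap_def)
      also have "\<dots> \<le> b j2"
        using b_le[of "Suc j1" j2] \<open>j1 < j2\<close> J(1)[OF j(3)] by simp
      finally show ?thesis
        using div_mod_5_separated[of U "b j1" "b j2"] J(4)[OF j(1)] J(4)[OF j(3)] j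
        by (simp add: gap_def U_def numeral_2_eq_2)
    qed
    \<comment> \<open>The sub-block spans less than half of a chunk shorter than
      \<open>2 * U\<close>, so every tail gap is below \<open>U\<close> and thus below the first
      gap.\<close>
    obtain B c d where B: "B \<subseteq> A" "card B = m" "B \<subseteq> {c..c + d}" "b jl \<le> c" "2 * d < gap b jl"
      using half[OF J(1)[OF j(5)]] by blast
    have "contains_wave k (\<lambda>j. f (s + j)) B"
      using B A by (intro bounded_byD[OF tail, of _ a N]) (auto simp: m_def)
    then obtain y where y: "wave k (\<lambda>j. f (s + j)) y" "y ` {1..k + 1} \<subseteq> B"
      by (auto simp: contains_wave_def)
    then have yB: "y i \<in> B" if "1 \<le> i" "i \<le> Suc k" for i
      using that by auto
    have "y 1 \<in> {c..c + d}"
      by (rule subsetD[OF B(3) yB]) auto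
    moreover have "y (Suc k) \<in> {c..c + d}"
      by (rule subsetD[OF B(3) yB]) auto
    ultimately have yU: "x s \<le> y 1" "y (Suc k) - y 1 < U"
      using B(4,5) J(3)[OF j(5)] j(6) by auto
    let ?w = "\<lambda>i. if i = 1 then x 1 else if i = 2 then b (Suc j1) else
      if i \<le> s then x (i - 1) else y (i - s)"
    have "wave (s + k) f ?w"
    proof (rule wave_insert_second[where U = U])
      show "0 < U" by (simp add: U_def)
      show "U \<le> b (Suc j1) - x 1" "b (Suc j1) - x 1 < 2 * U"
        using J(2,3)[OF j(1)] j(2) by (simp_all add: gap_def)
    qed (fact s x(1) sep f y(1) yU)+
    moreover have "?w i \<in> A" if "i \<in> {1..s + k + 1}" for i
    proof -
      have "b ` J \<subseteq> A"
        using b_in(1)[OF J(1)] by (rule image_subsetI)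
      then have "x i \<in> A" if "1 \<le> i" "i \<le> s" for i
        using x_in[OF that] by (rule subsetD)
      moreover have "b (Suc j1) \<in> A"
        using b_in(2)[OF J(1)[OF j(1)]] .
      moreover have "y i \<in> A" if "1 \<le> i" "i \<le> Suc k" for i
        using yB[OF that] B(1) by blast
      ultimately show ?thesis
        using s that by auto
    qed
    ultimately show False
      using no unfolding contains_wave_def by blast
  qed
  have "card A - 1 < 2 * m * (K + 1)"
    using m dividend_less_times_div[of "2 * m" "card A - 1"] by (simp add: K_def algebra_simps)
  then have "card A \<le> 2 * m * (K + 1)" by linarith
  \<comment> \<open>The 6 combines the 5 residue classes in the bound for \<open>K\<close> with the
    extra chunk in \<open>K + 1\<close>.\<close>
  also have "\<dots> \<le> 2 * ((C + 1) * (N + 1) ^ e) * (6 * (N + 1) ^ (s - 1))"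
  proof (intro mult_mono)
    have "1 \<le> (N + 1) ^ e" by simp
    then show "m \<le> (C + 1) * (N + 1) ^ e" by (simp add: m_def)
    have "K + 1 \<le> 5 * (N * H) + 1"
      using \<open>K \<le> _\<close> by simp
    also have "\<dots> \<le> 5 * ((N + 1) * H) + (N + 1) * H"
    proof (intro add_mono)
      have "0 < (N + 1) * H" by (simp add: H_def)
      then show "1 \<le> (N + 1) * H" by linarith
    qed auto
    also have "\<dots> = 6 * (N + 1) ^ (s - 1)"
    proof -
      have "s - 1 = Suc (s - 2)" using s by simp
      then show ?thesis by (simp only: H_def power_Suc)
    qed
    finally show "K + 1 \<le> 6 * (N + 1) ^ (s - 1)" .
  qed auto
  also have "\<dots> = 12 * (C + 1) * (N + 1) ^ ((s - 1) + e)"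
    unfolding power_add by (simp only: ac_simps)
  finally show "card A \<le> 12 * (C + 1) * (N + 1) ^ ((s - 1) + e)" .
qed

lemma layer_exponent_bounded:
  assumes "layer_exponent k f e"
  shows "\<exists>C. bounded_by k f C e"
  using assms
proof (induction rule: layer_exponent.induct)
  case (single s f)
  have "contains_wave s f A \<longleftrightarrow> contains_wave s id A" for A
    using wave_increasing[OF single(2)] by (simp add: contains_wave_def)
  then have "bounded_by s f 1 (s - 1)"
    using bounded_by_increasing[OF single(1)] by (simp add: bounded_by_def)
  then show ?case ..
next
  case (layer s f k e)
  then obtain C where C: "bounded_by k (\<lambda>j. f (s + j)) C e" by blast
  show ?case
  proof (cases "s = 1")
    case True
    then show ?thesis
      using bounded_by_layer_1[of k f C e] C layer by auto
  next
    case False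
    then show ?thesis
      using bounded_by_layer_2[OF C _ layer(2,3)] layer(1) by auto
  qed
qed

section \<open>Colorings\<close>

text \<open>A point \<open>z\<close> is \<open>q * h z\<close> plus an error from a window of width
  \<open>\<mu>\<close>, so a gap is off by at most \<open>\<mu> - 1\<close>. Two such errors stay
  below \<open>q\<close> and cannot reverse two distinct gaps of the images. Equality of images gaps
  remains possible, which is why the weak pattern has to be avoided.\<close>

lemma weak_free_perturb:
  assumes A: "weak_free k f A" "\<And>z. z \<in> S \<Longrightarrow> h z \<in> A" "inj_on h S"
    and q: "2 * \<mu> - 1 \<le> q" "0 < q"
    and r: "\<And>z. z \<in> S \<Longrightarrow> c \<le> z - q * h z \<and> z - q * h z < c + \<mu>"
  shows "\<not> contains_wave k f S"
proof
  assume "contains_wave k f S"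
  then obtain x where x: "wave k f x" "x ` {1..k + 1} \<subseteq> S"
    by (auto simp: contains_wave_def)
  have xS: "x i \<in> S" "x (Suc i) \<in> S" if "i \<in> {1..k}" for i
    using x(2) that by (auto simp: image_subset_iff)
  define w where "w = (\<lambda>i. h (x i))"
  have gap_w: "\<bar>gap x i - q * gap w i\<bar> \<le> \<mu> - 1" if "i \<in> {1..k}" for i
    using r[OF xS(1)[OF that]] r[OF xS(2)[OF that]]
    unfolding gap_def w_def right_diff_distrib by linarith
  have pos: "0 < gap w i" if i: "i \<in> {1..k}" for i
  proof -
    have gx: "0 < gap x i"
      using x(1) i by (simp add: wave_gap_iff)
    have "gap w i \<noteq> 0"
      using inj_onD[OF A(3) _ xS(2)[OF i] xS(1)[OF i]] gx by (auto simp: gap_def w_def)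
    moreover have "\<not> gap w i \<le> - 1"
    proof
      assume "gap w i \<le> - 1"
      then have "q * gap w i \<le> q * (- 1)"
        using q by (intro mult_left_mono) auto
      then show False
        using gap_w[OF i] gx q by linarith
    qed
    ultimately show ?thesis by linarith
  qed
  have "gap w j \<le> gap w i" if ij: "i \<in> {1..k}" "j \<in> {1..k}" "f j < f i" for i j
  proof (rule ccontr)
    assume "\<not> gap w j \<le> gap w i"
    then have "q * (gap w i + 1) \<le> q * gap w j"
      using q by (intro mult_left_mono) auto
    moreover have "gap x j < gap x i"
      using x(1) ij by (simp add: wave_gap_iff)
    ultimately show False
      using gap_w[OF ij(1)] gap_w[OF ij(2)] q by (simp add: distrib_left)
  qed
  with pos have "weak_wave k f w"
    unfolding weak_wave_def by blast
  moreover have "w ` {1..k + 1} \<subseteq> A"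
    using A(2) x(2) by (auto simp: w_def)
  ultimately show False
    using A(1) by (simp add: weak_free_def)
qed

text \<open>Residues modulo \<open>m\<close> index the elements of \<open>A\<close>. A color class
  contains at most one point \<open>z\<close> of each residue, the one for which
  \<open>z - (2 * m + 1) * a z\<close> falls into a fixed window of length \<open>m\<close>. It is
  therefore a perturbed, dilated and translated part of \<open>A\<close>, and different windows give
  the different colors.\<close>

lemma wave_free_coloring:
  fixes D :: nat
  assumes A: "weak_free k f A" "A \<subseteq> {0..<int D}" "card A = \<mu>" "1 \<le> \<mu>"
    and r: "q + 3 * D + 1 \<le> r"
  shows "\<exists>c \<in> {1..int (\<mu> * q)} \<rightarrow> {1..r}. \<forall>t. \<not> contains_wave k f {y \<in> {1..int (\<mu> * q)}. c y = t}"
proof -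
  have "finite A" using A(2) finite_subset by blast
  then obtain h where h: "bij_betw h {0..<\<mu>} A"
    using ex_bij_betw_nat_finite A(3) by metis
  define m where "m = int \<mu>"
  have m: "0 < m" using A(4) by (simp add: m_def)
  define a where "a = (\<lambda>z. h (nat (z mod m)))"
  have idx: "nat (z mod m) \<in> {0..<\<mu>}" for z
    using m by (simp add: m_def nat_less_iff)
  have aA: "a z \<in> A" for z
    using bij_betwE[OF h] idx by (simp add: a_def)
  define v where "v = (\<lambda>z. (z - (2 * m + 1) * a z) div m)"
  \<comment> \<open>On the interval \<open>v\<close> ranges from \<open>- 3 * D\<close> to
    \<open>q\<close>, the lower end because \<open>(2 * m + 1) * a z\<close> is at most
    \<open>3 * m * D\<close>. The shift moves the values into \<open>{1..r}\<close>.\<close>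
  define c where "c = (\<lambda>z. nat (v z + 3 * int D + 1))"
  have v: "0 \<le> v z + 3 * int D" "v z \<le> int q" if z: "z \<in> {1..int (\<mu> * q)}" for z
  proof -
    have az: "0 \<le> a z" "a z \<le> int D - 1"
      using aA[of z] A(2) by auto
    then have "(2 * m + 1) * a z \<le> (3 * m) * int D"
      using m by (intro mult_mono) auto
    then have "m * (- 3 * int D) \<le> z - (2 * m + 1) * a z"
      using z by (simp add: algebra_simps)
    then have "(m * (- 3 * int D)) div m \<le> v z"
      unfolding v_def using m by (intro zdiv_mono1)
    moreover have "(m * (- 3 * int D)) div m = - 3 * int D"
      using m by (intro nonzero_mult_div_cancel_left) simp
    ultimately show "0 \<le> v z + 3 * int D" by linarith
    have "0 \<le> (2 * m + 1) * a z"
      using az m by (intro mult_nonneg_nonneg) auto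
    then have "z - (2 * m + 1) * a z \<le> m * int q"
      using z by (simp add: m_def)
    then have "v z \<le> (m * int q) div m"
      unfolding v_def using m by (intro zdiv_mono1)
    then show "v z \<le> int q" using m by simp
  qed
  have c_range: "c \<in> {1..int (\<mu> * q)} \<rightarrow> {1..r}"
  proof
    fix z assume "z \<in> {1..int (\<mu> * q)}"
    from v[OF this] show "c z \<in> {1..r}"
      using r by (simp add: c_def le_nat_iff nat_le_iff)
  qed
  have "\<not> contains_wave k f {y \<in> {1..int (\<mu> * q)}. c y = t}" for t
  proof (rule weak_free_perturb[OF A(1), where h = a and \<mu> = m and q = "2 * m + 1"])
    let ?S = "{y \<in> {1..int (\<mu> * q)}. c y = t}"
    let ?\<kappa> = "int t - 3 * int D - 1"
    have vz: "v z = ?\<kappa>" if "z \<in> ?S" for z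
      using that v(1)[of z] by (auto simp: c_def)
    have decomp: "z - (2 * m + 1) * a z = m * v z + (z - (2 * m + 1) * a z) mod m" for z
      unfolding v_def by simp
    show bounds: "m * ?\<kappa> \<le> z - (2 * m + 1) * a z \<and> z - (2 * m + 1) * a z < m * ?\<kappa> + m"
      if "z \<in> ?S" for z
      using decomp[of z] pos_mod_sign[OF m, of "z - (2 * m + 1) * a z"]
        pos_mod_bound[OF m, of "z - (2 * m + 1) * a z"] unfolding vz[OF that] by linarith
    show "inj_on a ?S"
    proof (rule inj_onI)
      fix y z assume yz: "y \<in> ?S" "z \<in> ?S" and eq: "a y = a z"
      have "inj_on h {0..<\<mu>}" using h by (simp add: bij_betw_def)
      then have "nat (y mod m) = nat (z mod m)"
        using inj_onD[OF _ _ idx idx] eq unfolding a_def by blast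
      then have "y mod m = z mod m"
        using m by (simp add: eq_nat_nat_iff)
      then have "m dvd y - z" by (simp add: mod_eq_dvd_iff)
      moreover have "\<bar>y - z\<bar> < m"
        using bounds[OF yz(1)] bounds[OF yz(2)] unfolding eq by linarith
      ultimately show "y = z"
        using dvd_imp_le_int[of "y - z" m] m by auto
    qed
  qed (use aA m in auto)
  with c_range show ?thesis by blast
qed

section \<open>Transfer to \<open>g\<close> and \<open>P\<close>\<close>

lemma not_contains_wave_empty: "\<not> contains_wave k f {}"
  by (simp add: contains_wave_def)

lemma initial_segment_subset:
  assumes "M \<le> 2 ^ N"
  shows "{1..int M} \<subseteq> {1..<1 + 2 ^ N}"
proof -
  have "int M \<le> 2 ^ N"
    using iffD2[OF of_nat_le_iff assms] by (simp only: of_nat_power of_nat_numeral)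
  show ?thesis
  proof
    fix x assume "x \<in> {1..int M}"
    then have "1 \<le> x" "x \<le> int M" by simp_all
    with \<open>int M \<le> 2 ^ N\<close> have "1 \<le> x" "x < 1 + 2 ^ N" by linarith+
    then show "x \<in> {1..<1 + 2 ^ N}" by (simp only: atLeastLessThan_iff)
  qed
qed

lemma g_upper:
  assumes "bounded_by k f C e" "n \<le> 2 ^ N"
  shows "g k f n \<le> C * (N + 1) ^ e"
proof -
  have fin: "finite {A. A \<subseteq> {1..int n} \<and> \<not> contains_wave k f A}"
    by (rule finite_subset[of _ "Pow {1..int n}"]) auto
  have "card A \<le> C * (N + 1) ^ e" if "A \<subseteq> {1..int n}" "\<not> contains_wave k f A" for A
    using assms(1)[unfolded bounded_by_def, rule_format]
      order_trans[OF that(1) initial_segment_subset[OF assms(2)]] that(2) .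
  then show ?thesis
    unfolding g_def using fin not_contains_wave_empty by (subst Max_le_iff) auto
qed

lemma g_lower:
  assumes "weak_free k f A" "A \<subseteq> {0..<int D}" "D \<le> n"
  shows "card A \<le> g k f n"
proof -
  let ?S = "(\<lambda>a. a + 1) ` A"
  have fin: "finite {A. A \<subseteq> {1..int n} \<and> \<not> contains_wave k f A}"
    by (rule finite_subset[of _ "Pow {1..int n}"]) auto
  have "\<not> contains_wave k f ?S"
    \<comment> \<open>With \<open>\<mu> = 1\<close> and \<open>q = 1\<close> there is no
      perturbation, only a translation by 1 into the range of \<open>g\<close>.\<close>
    by (rule weak_free_perturb[OF assms(1), where h = "\<lambda>z. z - 1" and \<mu> = 1 and q = 1 and c = 1])
      (auto simp: inj_on_def)
  moreover have "?S \<subseteq> {1..int n}"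
    using assms(2,3) by force
  ultimately have "card ?S \<le> g k f n"
    unfolding g_def using fin by (intro Max_ge) auto
  then show ?thesis
    by (simp add: card_image inj_on_def)
qed

lemma monochromatic_wave:
  assumes "bounded_by k f C e" "r * (C * (N + 1) ^ e) < M" "M \<le> 2 ^ N"
    and c: "c \<in> {1..int M} \<rightarrow> {1..r}"
  shows "\<exists>q. contains_wave k f {y \<in> {1..int M}. c y = q}"
proof -
  have "\<exists>q. C * (N + 1) ^ e < card {y \<in> {1..int M}. c y = q}"
    using c assms(2) by (intro pigeonhole_color[of _ "{1..r}"]) auto
  then obtain q where q: "C * (N + 1) ^ e < card {y \<in> {1..int M}. c y = q}" by blast
  have "{y \<in> {1..int M}. c y = q} \<subseteq> {1..<1 + 2 ^ N}"
    using initial_segment_subset[OF assms(3)] by blast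
  then show ?thesis
    using bounded_byD[OF assms(1) _ q] by blast
qed

definition forces_wave :: "nat \<Rightarrow> (nat \<Rightarrow> nat) \<Rightarrow> nat \<Rightarrow> nat \<Rightarrow> bool" where
  "forces_wave k f r M \<longleftrightarrow> M > 0 \<and>
     (\<forall>c \<in> {1..int M} \<rightarrow> {1..r}. \<exists>q. contains_wave k f {y \<in> {1..int M}. c y = q})"

lemma P_eq_Least: "P k f r = (LEAST M. forces_wave k f r M)"
  by (simp only: P_def forces_wave_def)

lemma bounded_by_forces_wave:
  assumes "bounded_by k f C e" "r * (C * (N + 1) ^ e) < M" "M \<le> 2 ^ N"
  shows "forces_wave k f r M"
  unfolding forces_wave_def
proof (intro conjI ballI)
  show "0 < M" by (rule le_less_trans[OF le0 assms(2)])
qed (rule monochromatic_wave[OF assms])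

text \<open>A forcing \<open>M\<close> makes the least one attained. If it were at most
  \<open>card A * q\<close>, the coloring from \<open>wave_free_coloring\<close>, restricted to the
  shorter interval, would contradict it.\<close>

lemma P_gt:
  assumes M: "forces_wave k f r M"
    and A: "weak_free k f A" "A \<subseteq> {0..<int D}" "1 \<le> card A" "q + 3 * D + 1 \<le> r"
  shows "card A * q < P k f r"
proof (rule ccontr)
  assume le: "\<not> ?thesis"
  have "forces_wave k f r (P k f r)"
    unfolding P_eq_Least using M by (rule LeastI)
  then have force: "\<exists>q. contains_wave k f {y \<in> {1..int (P k f r)}. c y = q}"
    if "c \<in> {1..int (P k f r)} \<rightarrow> {1..r}" for c
    using that unfolding forces_wave_def by blast
  obtain c where c: "c \<in> {1..int (card A * q)} \<rightarrow> {1..r}"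
      "\<And>t. \<not> contains_wave k f {y \<in> {1..int (card A * q)}. c y = t}"
    using wave_free_coloring[OF A(1,2) refl A(3,4)] by blast
  have "P k f r \<le> card A * q"
    using le by simp
  then have "int (P k f r) \<le> int (card A * q)"
    by (simp only: of_nat_le_iff)
  then have sub: "{1..int (P k f r)} \<subseteq> {1..int (card A * q)}"
    by (intro atLeastatMost_subset_iff[THEN iffD2] disjI2 conjI) simp
  then have "c \<in> {1..int (P k f r)} \<rightarrow> {1..r}"
    using c(1) by blast
  then obtain t where "contains_wave k f {y \<in> {1..int (P k f r)}. c y = t}"
    using force by blast
  then have "contains_wave k f {y \<in> {1..int (card A * q)}. c y = t}"
    by (rule contains_wave_mono) (use sub in auto)
  with c(2) show False by blast
qed

section \<open>Asymptotics\<close>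

lemma ex_log_upper:
  fixes n :: nat
  assumes "2 \<le> n"
  shows "\<exists>N. n \<le> 2 ^ N \<and> real (N + 1) \<le> 3 / ln 2 * ln (real n)"
proof -
  obtain t where t: "2 ^ t < n" "n \<le> 2 ^ (t + 1)"
    using ex_power_ivl2[of 2 n] assms by auto
  have "real (2 ^ t) \<le> real n"
    using t(1) by (simp only: of_nat_le_iff)
  then have "ln (2 ^ t) \<le> ln (real n)"
    by (intro ln_mono) auto
  then have "real t * ln 2 \<le> ln (real n)"
    by (simp add: ln_realpow)
  moreover have "ln 2 \<le> ln (real n)"
    using assms by (intro ln_mono) auto
  \<comment> \<open>The binary logarithm of \<open>n\<close> is at least \<open>t\<close> and at
    least 1; the latter is used twice, whence the 3.\<close>
  ultimately have "real (t + 1 + 1) * ln 2 \<le> 3 * ln (real n)"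
    by (simp add: algebra_simps)
  then have "real (t + 1 + 1) \<le> 3 / ln 2 * ln (real n)"
    by (simp add: field_simps)
  with t(2) show ?thesis by blast
qed

text \<open>The exponent \<open>m\<close> is maximal with \<open>2 ^ (c * m)\<close> at most
  \<open>n div D\<close>. The size of \<open>n\<close> makes it positive, and maximality bounds
  \<open>ln n\<close>. The factor \<open>D\<close> reserves room for the coloring bound.\<close>

lemma ex_log_lower:
  fixes n D c :: nat
  assumes "1 \<le> c" "1 \<le> D" "D * 2 ^ c \<le> n"
  shows "\<exists>m\<ge>1. D * 2 ^ (c * m) \<le> n \<and> ln (real n) \<le> (ln (real D) + 2 * real c) * real m"
proof -
  have nD: "2 ^ c \<le> n div D"
    using assms(2,3) by (simp add: less_eq_div_iff_mult_less_eq mult.commute)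
  have "(2::nat) \<le> 2 ^ c" using power_increasing[OF assms(1), of "2::nat"] by simp
  moreover have "(1::nat) \<le> n div D" using nD one_le_power[of "2::nat" c] by linarith
  ultimately obtain m where m: "(2 ^ c) ^ m \<le> n div D" "n div D < (2 ^ c) ^ (m + 1)"
    using ex_power_ivl1 by blast
  have "m \<noteq> 0"
  proof
    assume "m = 0"
    with m(2) nD show False by simp
  qed
  then have m1: "1 \<le> m" by simp
  have "D * 2 ^ (c * m) \<le> n"
    using m(1) assms(2) by (simp add: less_eq_div_iff_mult_less_eq power_mult mult.commute)
  have "n < D * 2 ^ (c * (m + 1))"
    using m(2) assms(2) by (simp add: div_less_iff_less_mult power_mult [symmetric] mult.commute power_add [symmetric] algebra_simps)
  then have "real n \<le> real (D * 2 ^ (c * (m + 1)))"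
    by (simp only: of_nat_le_iff less_imp_le)
  then have "ln (real n) \<le> ln (real D * 2 ^ (c * (m + 1)))"
    using assms by (intro ln_mono) (auto intro: gr0I)
  also have "\<dots> = ln (real D) + real (c * (m + 1)) * ln 2"
    using assms(2) by (simp add: ln_mult ln_realpow)
  also have "\<dots> \<le> ln (real D) * real m + real (c * (m + m)) * 1"
  proof (intro add_mono mult_mono)
    have "0 \<le> ln (real D)" using assms(2) by simp
    then show "ln (real D) \<le> ln (real D) * real m"
      using m1 by (simp add: mult_le_cancel_left1)
    show "ln 2 \<le> (1::real)" using ln_le_minus_one[of "2::real"] by simp
    have "c * (m + 1) \<le> c * (m + m)" using m1 by (intro mult_le_mono2) simp
    then show "real (c * (m + 1)) \<le> real (c * (m + m))" by (simp only: of_nat_le_iff)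
  qed auto
  also have "\<dots> = (ln (real D) + 2 * real c) * real m"
    by (simp add: algebra_simps)
  finally have "ln (real n) \<le> (ln (real D) + 2 * real c) * real m" .
  with m1 \<open>D * 2 ^ (c * m) \<le> n\<close> show ?thesis
    by (intro exI[of _ m] conjI)
qed

lemma g_bigtheta:
  assumes L: "layer_exponent k f e"
  shows "(\<lambda>n. real (g k f n)) \<in> \<Theta>(\<lambda>n. ln (real n) ^ e)"
proof (rule bigthetaI)
  obtain C where C: "bounded_by k f C e"
    using layer_exponent_bounded[OF L] by blast
  show "(\<lambda>n. real (g k f n)) \<in> O(\<lambda>n. ln (real n) ^ e)"
  proof (rule bigoI)
    show "\<forall>\<^sub>F n in at_top. norm (real (g k f n)) \<le> (real C * (3 / ln 2) ^ e) * norm (ln (real n) ^ e)"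
      using eventually_ge_at_top[of 2]
    proof eventually_elim
      case (elim n)
      obtain N where N: "n \<le> 2 ^ N" "real (N + 1) \<le> 3 / ln 2 * ln (real n)"
        using ex_log_upper[OF elim] by blast
      have "real (g k f n) \<le> real (C * (N + 1) ^ e)"
        using g_upper[OF C N(1)] by (simp only: of_nat_le_iff)
      also have "\<dots> = real C * real (N + 1) ^ e" by simp
      also have "\<dots> \<le> real C * (3 / ln 2 * ln (real n)) ^ e"
        using N(2) by (intro mult_left_mono power_mono) auto
      also have "\<dots> = real C * (3 / ln 2) ^ e * ln (real n) ^ e"
        by (simp only: power_mult_distrib mult.assoc)
      finally show ?case
        using elim by simp
    qed
  qed
next
  obtain c where c: "\<And>m. m \<ge> 1 \<Longrightarrow>
      \<exists>A. A \<subseteq> {0..<2 ^ (c * m)} \<and> card A = m ^ e \<and> weak_free k f A"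
    using weak_free_sets[OF L] by blast
  \<comment> \<open>This is the factor from \<open>ex_log_lower\<close> with \<open>D = 1\<close>
    and \<open>c + 1\<close> in place of \<open>c\<close>, which may be 0.\<close>
  define B where "B = 2 * real (c + 1)"
  have B: "0 < B" by (simp add: B_def)
  show "(\<lambda>n. real (g k f n)) \<in> \<Omega>(\<lambda>n. ln (real n) ^ e)"
  proof (rule landau_omega.bigI)
    show "\<forall>\<^sub>F n in at_top. norm (real (g k f n)) \<ge> (1 / B ^ e) * norm (ln (real n) ^ e)"
      using eventually_ge_at_top[of "1 * 2 ^ (c + 1)"]
    proof eventually_elim
      case (elim n)
      obtain m where m: "1 \<le> m" "1 * 2 ^ ((c + 1) * m) \<le> n"
          "ln (real n) \<le> (ln (real 1) + 2 * real (c + 1)) * real m"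
        using ex_log_lower[OF _ _ elim] by auto
      obtain A where A: "A \<subseteq> {0..<2 ^ (c * m)}" "card A = m ^ e" "weak_free k f A"
        using c[OF m(1)] by blast
      have "(2::nat) ^ (c * m) \<le> 2 ^ ((c + 1) * m)"
        by (intro power_increasing) auto
      then have "2 ^ (c * m) \<le> n" using m(2) by linarith
      then have "m ^ e \<le> g k f n"
        using g_lower[OF A(3), of "2 ^ (c * m)" n] A(1,2) by simp
      then have "real (m ^ e) \<le> real (g k f n)"
        by (simp only: of_nat_le_iff)
      have "1 \<le> n" using elim one_le_power[of "2::nat" "c + 1"] by linarith
      then have "0 \<le> ln (real n)" by simp
      have "ln (real n) \<le> B * real m" using m(3) by (simp add: B_def)
      then have "ln (real n) ^ e \<le> (B * real m) ^ e"
        using \<open>0 \<le> ln (real n)\<close> by (rule power_mono)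
      also have "(B * real m) ^ e = B ^ e * real (m ^ e)"
        by (simp add: power_mult_distrib)
      also have "\<dots> \<le> B ^ e * real (g k f n)"
        using B \<open>real (m ^ e) \<le> real (g k f n)\<close> by (intro mult_left_mono) auto
      finally have "ln (real n) ^ e \<le> B ^ e * real (g k f n)" .
      then show ?case
        using B \<open>0 \<le> ln (real n)\<close> by (simp add: field_simps)
    qed
  qed (use B in simp)
qed

section \<open>Growth of \<open>P\<close>\<close>

lemma ex_P_scale:
  "\<exists>q0::nat. \<forall>q\<ge>q0. C * (2 * q + 1) ^ e + 1 \<le> 2 ^ q"
proof -
  have "eventually (\<lambda>q::nat. real C * (2 * real q + 1) ^ e + 1 \<le> 2 ^ q) at_top"
    by real_asymp
  then obtain q0 where q0: "\<And>q. q \<ge> q0 \<Longrightarrow> real C * (2 * real q + 1) ^ e + 1 \<le> 2 ^ q"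
    by (auto simp: eventually_at_top_linorder)
  have "C * (2 * q + 1) ^ e + 1 \<le> 2 ^ q" if "q \<ge> q0" for q
  proof -
    have "real (C * (2 * q + 1) ^ e + 1) \<le> real (2 ^ q)"
      using q0[OF that] by (simp add: add.commute)
    then show ?thesis by (simp only: of_nat_le_iff)
  qed
  then show ?thesis by blast
qed

text \<open>The forcing length must fit into \<open>2 ^ N\<close> although it depends on
  \<open>N\<close> itself. For \<open>r \<le> 2 ^ q\<close> the choice \<open>N = 2 * q\<close> is
  consistent: one factor \<open>2 ^ q\<close> covers \<open>r\<close>, the other covers the
  polynomial in \<open>q\<close>.\<close>

lemma P_scale:
  fixes r q :: nat
  assumes "C * (2 * q + 1) ^ e + 1 \<le> 2 ^ q" "r \<le> 2 ^ q"
  shows "r * (C * (2 * q + 1) ^ e) + 1 \<le> 2 ^ (2 * q)"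
proof -
  have "r * (C * (2 * q + 1) ^ e) + 1 \<le> 2 ^ q * (C * (2 * q + 1) ^ e) + 2 ^ q"
    using assms(2) by (intro add_mono mult_right_mono) auto
  also have "\<dots> = 2 ^ q * (C * (2 * q + 1) ^ e + 1)" by simp
  also have "\<dots> \<le> 2 ^ q * 2 ^ q"
    using assms(1) by (intro mult_left_mono) auto
  finally show ?thesis by (simp add: mult_2 power_add)
qed

lemma P_bigtheta:
  assumes L: "layer_exponent k f e"
  shows "(\<lambda>r. real (P k f r)) \<in> \<Theta>(\<lambda>r. real r * ln (real r) ^ e)"
proof (rule bigthetaI)
  obtain C where C: "bounded_by k f C e"
    using layer_exponent_bounded[OF L] by blast
  obtain q0 where q0: "\<And>q. q \<ge> q0 \<Longrightarrow> C * (2 * q + 1) ^ e + 1 \<le> 2 ^ q"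
    using ex_P_scale by blast
  show "(\<lambda>r. real (P k f r)) \<in> O(\<lambda>r. real r * ln (real r) ^ e)"
  proof (rule bigoI)
    have "eventually (\<lambda>r::nat. 1 \<le> ln (real r)) at_top" by real_asymp
    then show "\<forall>\<^sub>F r in at_top. norm (real (P k f r)) \<le> (real C * (6 / ln 2) ^ e + 1) * norm (real r * ln (real r) ^ e)"
      using eventually_ge_at_top[of "2 + 2 ^ q0"]
    proof eventually_elim
      case (elim r)
      then have "2 \<le> r" by simp
      then obtain q where q: "r \<le> 2 ^ q" "real (q + 1) \<le> 3 / ln 2 * ln (real r)"
        using ex_log_upper by blast
      have "(2::nat) ^ q0 < 2 ^ q" using elim(2) q(1) by linarith
      then have "q0 \<le> q" by simp
      have "P k f r \<le> r * (C * (2 * q + 1) ^ e) + 1"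
        unfolding P_eq_Least using P_scale[OF q0[OF \<open>q0 \<le> q\<close>] q(1)]
        by (intro Least_le bounded_by_forces_wave[OF C, where N = "2 * q"]) simp_all
      then have "real (P k f r) \<le> real (r * (C * (2 * q + 1) ^ e) + 1)"
        by (simp only: of_nat_le_iff)
      also have "\<dots> = real r * (real C * real (2 * q + 1) ^ e) + 1" by simp
      also have "\<dots> \<le> real r * (real C * (6 / ln 2 * ln (real r)) ^ e) + real r * ln (real r) ^ e"
      proof (intro add_mono mult_left_mono power_mono)
        show "real (2 * q + 1) \<le> 6 / ln 2 * ln (real r)"
          using q(2) by simp
        have "1 * 1 \<le> real r * ln (real r) ^ e"
          using elim(1) \<open>2 \<le> r\<close> by (intro mult_mono one_le_power) auto
        then show "1 \<le> real r * ln (real r) ^ e" by simp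
      qed auto
      also have "\<dots> = (real C * (6 / ln 2) ^ e + 1) * (real r * ln (real r) ^ e)"
        by (simp only: power_mult_distrib distrib_right distrib_left mult_1_left mult_1_right ac_simps)
      finally show ?case
        using elim(1) by simp
    qed
  qed
next
  obtain C where C: "bounded_by k f C e"
    using layer_exponent_bounded[OF L] by blast
  obtain q0 where q0: "\<And>q. q \<ge> q0 \<Longrightarrow> C * (2 * q + 1) ^ e + 1 \<le> 2 ^ q"
    using ex_P_scale by blast
  obtain c where c: "\<And>m. m \<ge> 1 \<Longrightarrow>
      \<exists>A. A \<subseteq> {0..<2 ^ (c * m)} \<and> card A = m ^ e \<and> weak_free k f A"
    using weak_free_sets[OF L] by blast
  define B where "B = ln 16 + 2 * real (c + 1)"
  have B: "0 < B" by (simp add: B_def add_nonneg_pos)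
  show "(\<lambda>r. real (P k f r)) \<in> \<Omega>(\<lambda>r. real r * ln (real r) ^ e)"
  proof (rule landau_omega.bigI)
    show "\<forall>\<^sub>F r in at_top. norm (real (P k f r)) \<ge> (1 / (4 * B ^ e)) * norm (real r * ln (real r) ^ e)"
      using eventually_ge_at_top[of "16 * 2 ^ (c + 1)"]
    proof eventually_elim
      case (elim r)
      obtain m where m: "1 \<le> m" "16 * 2 ^ ((c + 1) * m) \<le> r"
          "ln (real r) \<le> (ln (real 16) + 2 * real (c + 1)) * real m"
        using ex_log_lower[OF _ _ elim] by auto
      obtain A where A: "A \<subseteq> {0..<2 ^ (c * m)}" "card A = m ^ e" "weak_free k f A"
        using c[OF m(1)] by blast
      define D :: nat where "D = 2 ^ (c * m)"
      have "D \<le> 2 ^ ((c + 1) * m)"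
        unfolding D_def by (intro power_increasing) auto
      then have D: "16 * D \<le> r" using m(2) by linarith
      have "1 \<le> D" by (simp add: D_def)
      \<comment> \<open>Any forcing length will do here, so \<open>p\<close> is simply large enough
        for \<open>P_scale\<close>.\<close>
      define p where "p = max q0 r"
      \<comment> \<open>Half of the colors serve as the \<open>q\<close> of \<open>P_gt\<close>; as
        \<open>16 * D \<le> r\<close>, the \<open>3 * D + 1\<close> additional colors fit into the
        other half.\<close>
      have "m ^ e * (r div 2) < P k f r"
        unfolding A(2) [symmetric]
      proof (rule P_gt)
        have "r \<le> 2 ^ p"
          using less_exp[of p] unfolding p_def by (metis less_imp_le max.cobounded2 order_trans)
        then have "r * (C * (2 * p + 1) ^ e) + 1 \<le> 2 ^ (2 * p)"
          by (intro P_scale q0) (auto simp: p_def)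
        then show "forces_wave k f r (2 ^ (2 * p))"
          by (intro bounded_by_forces_wave[OF C, where N = "2 * p"]) simp_all
        show "A \<subseteq> {0..<int D}" using A(1) by (simp add: D_def)
        show "1 \<le> card A" using m(1) A(2) by simp
        show "r div 2 + 3 * D + 1 \<le> r" using D \<open>1 \<le> D\<close> by linarith
      qed (rule A(3))
      then have "real (m ^ e * (r div 2)) \<le> real (P k f r)"
        by (simp only: of_nat_le_iff less_imp_le)
      moreover have "1 \<le> r" using D \<open>1 \<le> D\<close> by linarith
      then have ln0: "0 \<le> ln (real r)" by simp
      have "ln (real r) ^ e \<le> (B * real m) ^ e"
        using m(3) ln0 by (intro power_mono) (auto simp: B_def)
      moreover have "real r \<le> 4 * real (r div 2)"
        using D \<open>1 \<le> D\<close> by linarith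
      ultimately have "real r * ln (real r) ^ e \<le> 4 * real (r div 2) * (B * real m) ^ e"
        using ln0 by (intro mult_mono) auto
      also have "\<dots> = 4 * B ^ e * real (m ^ e * (r div 2))"
        by (simp add: power_mult_distrib)
      also have "\<dots> \<le> 4 * B ^ e * real (P k f r)"
        using B \<open>real (m ^ e * (r div 2)) \<le> real (P k f r)\<close> by (intro mult_left_mono) auto
      finally have "real r * ln (real r) ^ e \<le> 4 * B ^ e * real (P k f r)" .
      then show ?case
        using B ln0 by (simp add: field_simps)
    qed
  qed (use B in simp)
qed

theorem theorem1p16:
  fixes k l :: nat and \<pi> :: "nat \<Rightarrow> nat"
  assumes "k \<ge> 1"
    and "\<pi> permutes {1..k}"
    and "layered k \<pi>"
    and "l = num_big_nonfinal_layers k \<pi>"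
  shows "(\<lambda>n::nat. real (g k \<pi> n)) \<in> \<Theta>(\<lambda>n. ln (real n) ^ (k - l - 1))
       \<and> (\<lambda>r::nat. real (P k \<pi> r)) \<in> \<Theta>(\<lambda>r. real r * ln (real r) ^ (k - l - 1))"
  using layered_imp_layer_exponent[OF assms(3,1)] g_bigtheta P_bigtheta assms(4) by blast

end
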